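(* The problem of deciding whether a parametric Timed Automaton with only one clock and one parameter accepts an empty set of timed $\omega$-words is decidable. That is, there is an algorithm which, given a parametric Timed Automaton $\mathcal{A}$ with one clock and one parameter $\mu$, decides whether there exist a parameter evaluation $\mathcal{I}$ and a timed $\omega$-word $(\pi,\tau)$ such that $\mathcal{A}$ has an accepting parametric run over $(\pi,\tau)$ with parameter evaluation $\mathcal{I}$.
   Context: Timed words. Let $\Sigma$ be a finite alphabet. A timed $\omega$-word over $\Sigma$ is a pair $(\pi,\tau)$ with $\pi:\mathbb{N}_{>0}\to\Sigma$ and $\tau:\mathbb{N}_{>0}\to\mathbb{R}_{\ge 0}$ such that $\tau(i)<\tau(i+1)$ for all $i>0$; conventionally $\tau(0)=0$. Clocks and constraints. Let $X$ be a finite set of clocks and $P$ a finite set of parameters. $\Gamma(X)$ is the set of clock constraints $\gamma := x\sim c \mid x\sim \mu \mid \neg\gamma \mid \gamma\wedge\gamma$, where $\sim\in\{<,=\}$, $x\in X$, $c\in\mathbb{N}_{\ge 0}$, $\mu\in P$. A clock valuation is a function $v:X\to\mathbb{R}_{\ge 0}$; for $t\in\mathbb{R}_{\geq 0}$, $(v+t)(x)=v(x)+t$ for all $x\in X$. A parameter evaluation is a map $\mathcal{I}:P\to\mathbb{R}$. $v,\mathcal{I}\models\gamma$ means that $\gamma$ is satisfied when clocks are interpreted by $v$ and parameters by $\mathcal{I}$. Parametric Timed Automata. A parametric Timed Automaton (TA) is a tuple $\mathcal{A}=(\Sigma,Q,T,q_0,B,P)$ where $Q$ is a finite set of control states, $q_0\in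 Q$ is the initial state, $B\subseteq Q$ (Büchi condition), and $T\subseteq Q\times Q\times\Gamma(X)\times\Sigma\times 2^X$ is a finite set of transitions, written $q\xrightarrow{\gamma,a,S}q'$ ($\gamma$ is the guard, $a$ the letter read, $S$ the set of clocks that are reset; a clock may be both tested in $\gamma$ and reset in $S$). Runs. A configuration is a pair $(q,v)$ with $q\in Q$ and $v$ a clock valuation. A parametric run of $\mathcal{A}$ over $(\pi,\tau)$ with parameter evaluation $\mathcal{I}$ is an infinite sequence of configurations $(q_{i_0},v_0)(q_{i_1},v_1)(q_{i_2},v_2)\dots$ such that $q_{i_0}=q_0$; there is a sequence of transitions $q_{i_0}\xrightarrow{\gamma_1,\pi(1),S_1}q_{i_1}\xrightarrow{\gamma_2,\pi(2),S_2}q_{i_2}\dots$ of $T$ with $v_{i-1}+\tau(i)-\tau(i-1),\mathcal{I}\models\gamma_i$ for all $i>0$; and, for all $x\in X$, $v_0(x)=0$ and for all $i>0$, $v_i(x)=0$ if $x\in S_i$ and $v_i(x)=v_{i-1}(x)+\tau(i)-\tau(i-1)$ otherwise. The run is accepting if some state of $B$ occurs in it infinitely often. *)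

theory Defs
  imports Complex_Main "HOL-Library.FuncSet" "HOL-Library.Nat_Bijection"
begin

section \<open>Timed words\<close>

text \<open>Words are indexed by the positive integers; position 0 carries only the convention that
  the time stamp at 0 is 0. Note that a first time stamp of 0 is allowed.\<close>

definition timed_words :: "'a set \<Rightarrow> ((nat \<Rightarrow> 'a) \<times> (nat \<Rightarrow> real)) set" where
  "timed_words \<Sigma> = {(\<pi>, \<tau>). \<pi> \<in> {0<..} \<rightarrow>\<^sub>E \<Sigma> \<and> \<tau> 0 = 0 \<and>
     (\<forall>i>0. 0 \<le> \<tau> i) \<and> (\<forall>i>0. \<tau> i < \<tau> (Suc i))}"

section \<open>Parametric timed automata\<close>

datatype (cc_clocks: 'x, cc_params: 'p) clock_constraint =
    LessConst 'x nat
  | EqConst 'x nat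
  | LessParam 'x 'p
  | EqParam 'x 'p
  | Neg "('x, 'p) clock_constraint"
  | Conj "('x, 'p) clock_constraint" "('x, 'p) clock_constraint"

definition clock_constraints :: "'x set \<Rightarrow> 'p set \<Rightarrow> ('x, 'p) clock_constraint set" where
  "clock_constraints X P = {\<gamma>. cc_clocks \<gamma> \<subseteq> X \<and> cc_params \<gamma> \<subseteq> P}"

primrec sat :: "('x \<Rightarrow> real) \<Rightarrow> ('p \<Rightarrow> real) \<Rightarrow> ('x, 'p) clock_constraint \<Rightarrow> bool" where
  "sat v I (LessConst x c) \<longleftrightarrow> v x < real c"
| "sat v I (EqConst x c) \<longleftrightarrow> v x = real c"
| "sat v I (LessParam x \<mu>) \<longleftrightarrow> v x < I \<mu>"
| "sat v I (EqParam x \<mu>) \<longleftrightarrow> v x = I \<mu>"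
| "sat v I (Neg \<gamma>) \<longleftrightarrow> \<not> sat v I \<gamma>"
| "sat v I (Conj \<gamma> \<gamma>') \<longleftrightarrow> sat v I \<gamma> \<and> sat v I \<gamma>'"

record ('a, 'q, 'x, 'p) pta =
  alphabet :: "'a set"
  clocks :: "'x set"
  states :: "'q set"
  transitions :: "('q \<times> 'q \<times> ('x, 'p) clock_constraint \<times> 'a \<times> 'x set) set"
  initial :: 'q
  buchi :: "'q set"
  params :: "'p set"

definition is_pta :: "('a, 'q, 'x, 'p) pta \<Rightarrow> bool" where
  "is_pta A \<longleftrightarrow>
     finite (alphabet A) \<and> finite (clocks A) \<and> finite (states A) \<and> finite (params A) \<and>
     initial A \<in> states A \<and> buchi A \<subseteq> states A \<and>
     finite (transitions A) \<and>
     transitions A \<subseteq> states A \<times> states A \<times> clock_constraints (clocks A) (params A)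
       \<times> alphabet A \<times> Pow (clocks A)"

definition configs :: "('a, 'q, 'x, 'p) pta \<Rightarrow> ('q \<times> ('x \<Rightarrow> real)) set" where
  "configs A = states A \<times> (clocks A \<rightarrow>\<^sub>E {0..})"

definition is_run ::
  "('a, 'q, 'x, 'p) pta \<Rightarrow> ('p \<Rightarrow> real) \<Rightarrow> (nat \<Rightarrow> 'a) \<times> (nat \<Rightarrow> real)
    \<Rightarrow> (nat \<Rightarrow> 'q \<times> ('x \<Rightarrow> real)) \<Rightarrow> bool" where
  "is_run A I = (\<lambda>(\<pi>, \<tau>) \<rho>.
     (\<forall>i. \<rho> i \<in> configs A) \<and>
     fst (\<rho> 0) = initial A \<and> (\<forall>x\<in>clocks A. snd (\<rho> 0) x = 0) \<and>
     (\<exists>\<gamma> S. \<forall>i>0.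
        (fst (\<rho> (i - 1)), fst (\<rho> i), \<gamma> i, \<pi> i, S i) \<in> transitions A \<and>
        sat (\<lambda>x. snd (\<rho> (i - 1)) x + (\<tau> i - \<tau> (i - 1))) I (\<gamma> i) \<and>
        (\<forall>x\<in>clocks A. snd (\<rho> i) x =
           (if x \<in> S i then 0 else snd (\<rho> (i - 1)) x + (\<tau> i - \<tau> (i - 1))))))"

definition accepting :: "('a, 'q, 'x, 'p) pta \<Rightarrow> (nat \<Rightarrow> 'q \<times> ('x \<Rightarrow> real)) \<Rightarrow> bool" where
  "accepting A \<rho> \<longleftrightarrow> (\<exists>q\<in>buchi A. infinite {i. fst (\<rho> i) = q})"

definition timed_language :: "('a, 'q, 'x, 'p) pta \<Rightarrow> ((nat \<Rightarrow> 'a) \<times> (nat \<Rightarrow> real)) set" where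
  "timed_language A = {w \<in> timed_words (alphabet A).
     \<exists>I \<in> params A \<rightarrow>\<^sub>E UNIV. \<exists>\<rho>. is_run A I w \<rho> \<and> accepting A \<rho>}"

section \<open>Decidability\<close>

text \<open>Kleene's partial recursive functions: \<open>computes f xs y\<close> says that the program \<open>f\<close>
  halts on the argument list \<open>xs\<close> with result \<open>y\<close>. Arities are implicit, so zero and the
  projections are available at every arity.\<close>

datatype recf =
    Zero
  | Succ
  | Proj nat
  | Comp recf "recf list"
  | PrimRec recf recf
  | Mu recf

inductive computes :: "recf \<Rightarrow> nat list \<Rightarrow> nat \<Rightarrow> bool" where
  zero: "computes Zero xs 0"
| succ: "computes Succ [x] (Suc x)"
| proj: "i < length xs \<Longrightarrow> computes (Proj i) xs (xs ! i)"
| comp: "list_all2 (\<lambda>g y. computes g xs y) gs ys \<Longrightarrow> computes f ys z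
    \<Longrightarrow> computes (Comp f gs) xs z"
| primrec_0: "computes f xs y \<Longrightarrow> computes (PrimRec f g) (0 # xs) y"
| primrec_Suc: "computes (PrimRec f g) (n # xs) y \<Longrightarrow> computes g (n # y # xs) z
    \<Longrightarrow> computes (PrimRec f g) (Suc n # xs) z"
| mu: "computes f (n # xs) 0 \<Longrightarrow> (\<forall>k<n. \<exists>y>0. computes f (k # xs) y)
    \<Longrightarrow> computes (Mu f) xs n"

lemma computes_deterministic: "computes f xs y \<Longrightarrow> computes f xs z \<Longrightarrow> y = z"
proof (induction arbitrary: z rule: computes.induct)
  case (comp xs gs ys f y)
  from comp.prems obtain zs where zs: "list_all2 (\<lambda>g y. computes g xs y) gs zs" "computes f zs z"
    by (auto elim: computes.cases)
  have "ys = zs"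
    using comp.IH(1) zs(1) by (auto simp: list_all2_conv_all_nth intro!: nth_equalityI)
  with comp.IH(2) zs(2) show ?case by simp
next
  case (primrec_Suc f g n xs y w)
  from primrec_Suc.prems obtain y' where "computes (PrimRec f g) (n # xs) y'" 
    "computes g (n # y' # xs) z"
    by (auto elim: computes.cases)
  with primrec_Suc.IH show ?case by auto
next
  case (mu f n xs)
  from mu.prems have z: "computes f (z # xs) 0" "\<forall>k<z. \<exists>y>0. computes f (k # xs) y"
    by (auto elim: computes.cases)
  have "\<not> n < z" using mu.IH(1) z(2) by (metis less_irrefl)
  moreover have "\<not> z < n" using mu.IH(2) z(1) by (metis less_irrefl)
  ultimately show ?case by simp
qed (erule computes.cases; simp)+

text \<open>The problem with instances \<open>D\<close>, presented to the program through the encoding \<open>enc\<close>,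
  and question \<open>R\<close> is decidable: one program halts on every instance and answers 1 or 0
  according to whether \<open>R\<close> holds.\<close>

definition decidable_problem :: "('i \<Rightarrow> nat) \<Rightarrow> 'i set \<Rightarrow> ('i \<Rightarrow> bool) \<Rightarrow> bool" where
  "decidable_problem enc D R \<longleftrightarrow>
     (\<exists>f. \<forall>A\<in>D. computes f [enc A] (if R A then 1 else 0))"

section \<open>Automata as inputs\<close>

text \<open>As inputs, automata have letters, states, clocks and parameters named by natural numbers.
  The functions \<open>prod_encode\<close> and \<open>set_encode\<close> (binary coding of a finite set) are the effective
  bijections of the library.\<close>

primrec cc_encode :: "(nat, nat) clock_constraint \<Rightarrow> nat" where
  "cc_encode (LessConst x c) = prod_encode (0, prod_encode (x, c))"
| "cc_encode (EqConst x c) = prod_encode (1, prod_encode (x, c))"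
| "cc_encode (LessParam x \<mu>) = prod_encode (2, prod_encode (x, \<mu>))"
| "cc_encode (EqParam x \<mu>) = prod_encode (3, prod_encode (x, \<mu>))"
| "cc_encode (Neg \<gamma>) = prod_encode (4, cc_encode \<gamma>)"
| "cc_encode (Conj \<gamma> \<gamma>') = prod_encode (5, prod_encode (cc_encode \<gamma>, cc_encode \<gamma>'))"

definition transition_encode ::
  "nat \<times> nat \<times> (nat, nat) clock_constraint \<times> nat \<times> nat set \<Rightarrow> nat" where
  "transition_encode = (\<lambda>(q, q', \<gamma>, a, S).
     prod_encode (q, prod_encode (q', prod_encode (cc_encode \<gamma>, prod_encode (a, set_encode S)))))"

definition pta_encode :: "(nat, nat, nat, nat) pta \<Rightarrow> nat" where
  "pta_encode A =
     prod_encode (set_encode (alphabet A),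
     prod_encode (set_encode (clocks A),
     prod_encode (set_encode (states A),
     prod_encode (set_encode (transition_encode ` transitions A),
     prod_encode (initial A,
     prod_encode (set_encode (buchi A),
       set_encode (params A)))))))"

lemma cc_encode_inject: "cc_encode \<gamma> = cc_encode \<gamma>' \<longleftrightarrow> \<gamma> = \<gamma>'"
  by (induction \<gamma> arbitrary: \<gamma>'; rename_tac \<gamma>'; case_tac \<gamma>'; simp)

lemma inj_on_transition_encode:
  "inj_on transition_encode {(q, q', \<gamma>, a, S). finite S}"
  by (auto simp: inj_on_def transition_encode_def cc_encode_inject set_encode_eq)

lemma inj_on_pta_encode: "inj_on pta_encode {A. is_pta A}"
proof (rule inj_onI)
  fix A B :: "(nat, nat, nat, nat) pta"
  assume "A \<in> {A. is_pta A}" "B \<in> {A. is_pta A}" and eq: "pta_encode A = pta_encode B"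
  then have A: "is_pta A" and B: "is_pta B" by auto
  have T: "transitions C \<subseteq> {(q, q', \<gamma>, a, S). finite S}" if "is_pta C"
    for C :: "(nat, nat, nat, nat) pta"
  proof
    fix t assume "t \<in> transitions C"
    with that have "t \<in> states C \<times> states C \<times> clock_constraints (clocks C) (params C)
        \<times> alphabet C \<times> Pow (clocks C)" and "finite (clocks C)"
      unfolding is_pta_def by blast+
    then show "t \<in> {(q, q', \<gamma>, a, S). finite S}"
      by (auto dest: finite_subset)
  qed
  have fin: "finite (buchi C)" if "is_pta C" for C :: "(nat, nat, nat, nat) pta"
    using that unfolding is_pta_def by (metis finite_subset)
  have "transition_encode ` transitions A = transition_encode ` transitions B"
    using eq A B by (simp add: pta_encode_def set_encode_eq is_pta_def)
  then have "transitions A = transitions B"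
    using inj_on_image_eq_iff[OF inj_on_transition_encode T[OF A] T[OF B]] by simp
  moreover have "alphabet A = alphabet B \<and> clocks A = clocks B \<and> states A = states B \<and>
      initial A = initial B \<and> buchi A = buchi B \<and> params A = params B"
    using eq A B fin[OF A] fin[OF B] by (simp add: pta_encode_def set_encode_eq is_pta_def)
  ultimately show "A = B" by simp
qed

end

theory Submission imports Defs "HOL-Library.Infinite_Set" begin

text \<open>With a single clock, the existence of a run depends only on the order of the clock values
  among themselves and relative to the constants and the parameter: between two resets the clock must
  increase, and after a reset only its comparison with 0 matters. Hence a parameter value matters
  only through its position relative to the constants of the guards. Up to an order
  automorphism fixing these constants it is negative, an integer, or a half-integer, which leaves
  finitely many cases. In each of them the clock has finitely many regions (half-integer points and
  the open intervals between them), and a timed word is accepted iff the finite graph of states and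
  regions contains a reachable cycle through a state of the Buechi condition. The existence of such
  a cycle is expressed with bounded quantifiers only, all bounds being computed from the code of
  the automaton (which exceeds every number occurring in it), so it is decided by a
  \<open>Mu\<close>-free program.\<close>

section \<open>Primitive recursive programs\<close>

text \<open>A total evaluator lets program correctness be proved by rewriting instead of by
  derivations of \<open>computes\<close>. The value at \<open>Mu\<close> is a dummy:
  \<open>arity\<close> rejects such programs.\<close>

fun ev :: "recf \<Rightarrow> nat list \<Rightarrow> nat" where
  "ev Zero xs = 0"
| "ev Succ xs = Suc (hd xs)"
| "ev (Proj i) xs = xs ! i"
| "ev (Comp f gs) xs = ev f (map (\<lambda>g. ev g xs) gs)"
| "ev (PrimRec f g) xs = rec_nat (ev f (tl xs)) (\<lambda>k y. ev g (k # y # tl xs)) (hd xs)"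
| "ev (Mu f) xs = 0"

fun arity :: "recf \<Rightarrow> nat \<Rightarrow> bool" where
  "arity Zero n \<longleftrightarrow> True"
| "arity Succ n \<longleftrightarrow> n = 1"
| "arity (Proj i) n \<longleftrightarrow> i < n"
| "arity (Comp f gs) n \<longleftrightarrow> arity f (length gs) \<and> (\<forall>g\<in>set gs. arity g n)"
| "arity (PrimRec f g) n \<longleftrightarrow> (\<exists>k. n = Suc k \<and> arity f k \<and> arity g (Suc (Suc k)))"
| "arity (Mu f) n \<longleftrightarrow> False"

text \<open>Without \<open>Mu\<close>, a program can fail to halt only by receiving a wrong number
  of arguments, for instance \<open>Succ\<close> on a list of length other than 1, and
  \<open>arity\<close> excludes this.\<close>

lemma computes_ev: "arity p (length xs) \<Longrightarrow> computes p xs (ev p xs)"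
proof (induction p arbitrary: xs)
  case Zero
  show ?case by (auto intro: computes.intros)
next
  case Succ
  then obtain x where "xs = [x]" by (auto simp: length_Suc_conv)
  then show ?case by (auto intro: computes.intros)
next
  case (Proj i)
  then show ?case by (auto intro: computes.intros)
next
  case (Comp f gs)
  then have "list_all2 (\<lambda>g y. computes g xs y) gs (map (\<lambda>g. ev g xs) gs)"
    by (auto simp: list_all2_conv_all_nth)
  moreover have "computes f (map (\<lambda>g. ev g xs) gs) (ev f (map (\<lambda>g. ev g xs) gs))"
    using Comp by auto
  ultimately show ?case by (auto intro: computes.comp)
next
  case (PrimRec f g)
  then obtain n ys where xs: "xs = n # ys" by (cases xs) auto
  have "computes (PrimRec f g) (k # ys) (ev (PrimRec f g) (k # ys))" for k
  proof (induction k)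
    case 0
    then show ?case using PrimRec by (auto simp: xs intro: computes.primrec_0)
  next
    case (Suc k)
    then show ?case using PrimRec by (auto simp: xs intro: computes.primrec_Suc)
  qed
  then show ?case by (simp only: xs)
qed auto

section \<open>Elementary arithmetic functions\<close>

primrec constR :: "nat \<Rightarrow> recf" where
  "constR 0 = Zero"
| "constR (Suc k) = Comp Succ [constR k]"

lemma constR [simp]: "ev (constR k) xs = k" "arity (constR k) n"
  by (induction k) auto

definition addR :: recf where "addR = PrimRec (Proj 0) (Comp Succ [Proj 1])"
definition mulR :: recf where "mulR = PrimRec Zero (Comp addR [Proj 1, Proj 2])"
definition pow2R :: recf where "pow2R = PrimRec (constR 1) (Comp addR [Proj 1, Proj 1])"
definition notR :: recf where "notR = PrimRec (constR 1) Zero"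
definition predR :: recf where "predR = PrimRec Zero (Proj 0)"
text \<open>Recursion runs on the first argument, so the number subtracted has to come first;
  \<open>LeqT\<close> swaps its operands accordingly.\<close>

definition rsubR :: recf where "rsubR = PrimRec (Proj 0) (Comp predR [Proj 1])"
definition triangleR :: recf where "triangleR = PrimRec Zero (Comp Succ [Comp addR [Proj 0, Proj 1]])"

lemma addR [simp]: "ev addR [a, b] = a + b" "arity addR (Suc (Suc 0))"
  by (induction a) (auto simp: addR_def)

lemma mulR [simp]: "ev mulR [a, b] = a * b" "arity mulR (Suc (Suc 0))"
  by (induction a) (auto simp: mulR_def)

lemma pow2R [simp]: "ev pow2R [a] = 2 ^ a" "arity pow2R (Suc 0)"
  by (induction a) (auto simp: pow2R_def)

lemma notR [simp]: "ev notR [a] = of_bool (a = 0)" "arity notR (Suc 0)"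
  by (cases a) (auto simp: notR_def)

lemma predR [simp]: "ev predR [a] = a - 1" "arity predR (Suc 0)"
  by (cases a) (auto simp: predR_def)

lemma rsubR [simp]: "ev rsubR [a, b] = b - a" "arity rsubR (Suc (Suc 0))"
  by (induction a) (auto simp: rsubR_def)

lemma triangleR [simp]: "ev triangleR [a] = triangle a" "arity triangleR (Suc 0)"
  by (induction a) (auto simp: triangleR_def)


section \<open>Terms: arithmetic, comparisons and propositional connectives\<close>

definition AddT (infixl "\<oplus>" 65) where "s \<oplus> t = Comp addR [s, t]"
definition TimesT (infixl "\<otimes>" 70) where "s \<otimes> t = Comp mulR [s, t]"
definition Pow2T where "Pow2T s = Comp pow2R [s]"
definition NotT (\<open>\<sim> _\<close> [90] 90) where "\<sim> s = Comp notR [s]"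
definition LeqT (infix "\<preceq>" 55) where "s \<preceq> t = \<sim> (Comp rsubR [t, s])"
definition LessT (infix "\<prec>" 55) where "s \<prec> t = (Comp Succ [s] \<preceq> t)"
text \<open>Truth is being non-zero. The double negation turns the product into 0 or 1;
  \<open>IffT\<close> compares negations because two true terms may have different values.\<close>

definition AndT (infixr "\<sqinter>" 54) where "s \<sqinter> t = (\<sim> (\<sim> (s \<otimes> t)))"
definition OrT (infixr "\<squnion>" 53) where "s \<squnion> t = (\<sim> ((\<sim> s) \<sqinter> (\<sim> t)))"
definition EqualT (infix "\<approx>" 55) where "s \<approx> t = ((s \<preceq> t) \<sqinter> (t \<preceq> s))"
definition IffT (infixr "\<triangleq>" 52) where "s \<triangleq> t = ((\<sim> s) \<approx> (\<sim> t))"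

lemma arith_ev [simp]:
  "ev (s \<oplus> t) xs = ev s xs + ev t xs" "arity (s \<oplus> t) n \<longleftrightarrow> arity s n \<and> arity t n"
  "ev (s \<otimes> t) xs = ev s xs * ev t xs" "arity (s \<otimes> t) n \<longleftrightarrow> arity s n \<and> arity t n"
  "ev (Pow2T s) xs = 2 ^ ev s xs" "arity (Pow2T s) n \<longleftrightarrow> arity s n"
  by (auto simp: AddT_def TimesT_def Pow2T_def)

lemma NotT [simp]: "ev (\<sim> s) xs = of_bool (ev s xs = 0)" "arity (\<sim> s) n \<longleftrightarrow> arity s n"
  by (auto simp: NotT_def)

lemma LeqT [simp]:
  "ev (s \<preceq> t) xs = of_bool (ev s xs \<le> ev t xs)" "arity (s \<preceq> t) n \<longleftrightarrow> arity s n \<and> arity t n"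
  by (auto simp: LeqT_def)

lemma LessT [simp]:
  "ev (s \<prec> t) xs = of_bool (ev s xs < ev t xs)" "arity (s \<prec> t) n \<longleftrightarrow> arity s n \<and> arity t n"
  by (auto simp: LessT_def)

lemma AndT [simp]:
  "ev (s \<sqinter> t) xs = of_bool (ev s xs \<noteq> 0 \<and> ev t xs \<noteq> 0)" "arity (s \<sqinter> t) n \<longleftrightarrow> arity s n \<and> arity t n"
  by (auto simp: AndT_def)

lemma OrT [simp]:
  "ev (s \<squnion> t) xs = of_bool (ev s xs \<noteq> 0 \<or> ev t xs \<noteq> 0)" "arity (s \<squnion> t) n \<longleftrightarrow> arity s n \<and> arity t n"
  by (auto simp: OrT_def)

lemma EqualT [simp]:
  "ev (s \<approx> t) xs = of_bool (ev s xs = ev t xs)" "arity (s \<approx> t) n \<longleftrightarrow> arity s n \<and> arity t n"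
  by (auto simp: EqualT_def)

lemma IffT [simp]:
  "ev (s \<triangleq> t) xs = of_bool (ev s xs \<noteq> 0 \<longleftrightarrow> ev t xs \<noteq> 0)"
  "arity (s \<triangleq> t) n \<longleftrightarrow> arity s n \<and> arity t n"
  by (auto simp: IffT_def)

text \<open>Quantified variables are addressed de Bruijn style: position 0 of the argument list of
  the body is the innermost one. The number \<open>a\<close> is the length of the outer argument list.\<close>

definition SumT :: "nat \<Rightarrow> recf \<Rightarrow> recf \<Rightarrow> recf" where
  "SumT a b p = Comp (PrimRec Zero (Comp addR [Proj 1, Comp p (Proj 0 # map Proj [2..<a + 2])]))
     (b # map Proj [0..<a])"

lemma arity_SumT [simp]:
  "arity b n \<Longrightarrow> arity p (Suc a) \<Longrightarrow> a \<le> n \<Longrightarrow> arity (SumT a b p) n"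
  by (auto simp: SumT_def simp del: upt_Suc)

lemma rec_nat_add: "rec_nat 0 (\<lambda>k y. y + f k) n = (\<Sum>k<n. f k :: nat)"
  by (induction n) auto

lemma ev_SumT [simp]:
  assumes "length xs = a"
  shows "ev (SumT a b p) xs = (\<Sum>k<ev b xs. ev p (k # xs))"
proof -
  \<comment> \<open>In the body of the recursion the accumulator sits at position 1, between the
    index and the outer list; the projections from 2 on skip it.\<close>
  have *: "map (\<lambda>i. ev (Proj i) (k # y # xs)) [2..<a + 2] = xs" for k y
    using assms by (intro nth_equalityI) (simp_all del: upt_Suc)
  have "map (\<lambda>i. ev (Proj i) xs) [0..<a] = xs"
    using assms by (auto intro!: nth_equalityI)
  then have "ev (SumT a b p) xs = rec_nat 0 (\<lambda>k y. y + ev p (k # xs)) (ev b xs)"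
    using * by (simp add: SumT_def comp_def del: upt_Suc)
  also have "\<dots> = (\<Sum>k<ev b xs. ev p (k # xs))"
    by (rule rec_nat_add)
  finally show ?thesis .
qed

text \<open>A bounded quantifier is a sum: a witness makes it non-zero, and for \<open>AllT\<close>
  the sum counts the counterexamples.\<close>

definition ExT where "ExT a b p = \<sim> (\<sim> (SumT a b p))"
definition AllT where "AllT a b p = \<sim> (SumT a b (\<sim> p))"

lemma ExT [simp]:
  "length xs = a \<Longrightarrow> ev (ExT a b p) xs = of_bool (\<exists>k<ev b xs. ev p (k # xs) \<noteq> 0)"
  "arity b n \<Longrightarrow> arity p (Suc a) \<Longrightarrow> a \<le> n \<Longrightarrow> arity (ExT a b p) n"
  by (auto simp: ExT_def)

lemma AllT [simp]:
  "length xs = a \<Longrightarrow> ev (AllT a b p) xs = of_bool (\<forall>k<ev b xs. ev p (k # xs) \<noteq> 0)"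
  "arity b n \<Longrightarrow> arity p (Suc a) \<Longrightarrow> a \<le> n \<Longrightarrow> arity (AllT a b p) n"
  by (auto simp: AllT_def)

section \<open>Decoding of pairs and of finite sets\<close>

definition tag :: "nat \<Rightarrow> nat" where "tag k = fst (prod_decode k)"
definition arg :: "nat \<Rightarrow> nat" where "arg k = snd (prod_decode k)"

lemma tag_arg_encode [simp]: "tag (prod_encode (a, b)) = a" "arg (prod_encode (a, b)) = b"
  by (simp_all add: tag_def arg_def)

lemma encode_tag_arg [simp]: "prod_encode (tag k, arg k) = k"
  by (simp add: tag_def arg_def)

lemma tag_le: "tag k \<le> k"
  using le_prod_encode_1[of "tag k" "arg k"] by simp

lemma arg_le: "arg k \<le> k"
  using le_prod_encode_2[of "arg k" "tag k"] by simp

lemma le_triangle: "k \<le> triangle k"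
  by (induction k) auto

text \<open>The code \<open>triangle (a + b) + a\<close> is at least \<open>b + 2 * a\<close>. The
  constructors with subformulas have tags 4 and 5, so passing to their argument is a strict descent;
  with tag 0 it need not be, as the code 0 shows.\<close>

lemma arg_less:
  assumes "0 < tag k"
  shows "arg k < k"
proof -
  have "arg k < triangle (tag k + arg k) + tag k"
    using le_triangle[of "tag k + arg k"] assms by linarith
  also have "\<dots> = k"
    using encode_tag_arg[of k] by (simp only: prod_encode_def split: prod.split) simp
  finally show ?thesis .
qed

text \<open>Unpairing by search: the indicator of the pairing equation keeps exactly one term of the
  sum. In the inner body \<open>Proj 1\<close> and \<open>Proj 0\<close> are the two entries and
  \<open>Proj 2\<close> is the code.\<close>

definition fstR :: recf where
  "fstR = SumT 1 (Comp Succ [Proj 0]) (SumT 2 (Comp Succ [Proj 1])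
     (Proj 1 \<otimes> (Comp triangleR [Proj 1 \<oplus> Proj 0] \<oplus> Proj 1 \<approx> Proj 2)))"

definition sndR :: recf where
  "sndR = SumT 1 (Comp Succ [Proj 0]) (SumT 2 (Comp Succ [Proj 1])
     (Proj 0 \<otimes> (Comp triangleR [Proj 1 \<oplus> Proj 0] \<oplus> Proj 1 \<approx> Proj 2)))"

lemma sum_prod_decode:
  fixes f :: "nat \<Rightarrow> nat \<Rightarrow> nat"
  shows "(\<Sum>a<Suc k. \<Sum>b<Suc k. f a b * of_bool (triangle (a + b) + a = k)) =
     f (tag k) (arg k)" (is "?L = _")
proof -
  let ?c = "tag k" and ?d = "arg k"
  have bound: "?c < Suc k" "?d < Suc k"
    by (simp_all add: tag_le arg_le less_Suc_eq_le)
  have eq: "triangle (a + b) + a = k \<longleftrightarrow> a = ?c \<and> b = ?d" for a b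
  proof -
    have "triangle (a + b) + a = k \<longleftrightarrow> prod_encode (a, b) = prod_encode (?c, ?d)"
      by (subst encode_tag_arg) (simp add: prod_encode_def)
    then show ?thesis by (simp only: prod_encode_eq prod.inject)
  qed
  have "?L = (\<Sum>a<Suc k. \<Sum>b<Suc k. if b = ?d then if a = ?c then f ?c ?d else 0 else 0)"
    by (intro sum.cong refl) (auto simp: eq)
  also have "\<dots> = f ?c ?d"
    using bound by (simp only: sum.delta finite_lessThan lessThan_iff if_True)
  finally show ?thesis .
qed

lemma fstR [simp]: "ev fstR [k] = tag k" "arity fstR (Suc 0)"
  using sum_prod_decode[of "\<lambda>a b. a" k] by (auto simp: fstR_def simp del: sum.lessThan_Suc)

lemma sndR [simp]: "ev sndR [k] = arg k" "arity sndR (Suc 0)"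
  using sum_prod_decode[of "\<lambda>a b. b" k] by (auto simp: sndR_def simp del: sum.lessThan_Suc)

definition bitR :: recf where
  "bitR = ExT 2 (Comp Succ [Proj 1]) (ExT 3 (Pow2T (Proj 1))
     ((Proj 1 \<oplus> Proj 1 \<oplus> constR 1) \<otimes> Pow2T (Proj 2) \<oplus> Proj 0 \<approx> Proj 3))"

text \<open>Bit \<open>k\<close> is set iff the quotient by \<open>2 ^ k\<close> is odd, say
  \<open>2 * a + 1\<close>, with remainder \<open>b\<close>. Bounded witnesses for both replace a
  program for division.\<close>

lemma mem_set_decode_iff:
  "k \<in> set_decode X \<longleftrightarrow> (\<exists>a<Suc X. \<exists>b<2 ^ k. (a + a + 1) * 2 ^ k + b = X)"
proof
  assume "k \<in> set_decode X"
  then obtain a where a: "X div 2 ^ k = 2 * a + 1"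
    by (auto simp: set_decode_def elim: oddE)
  moreover have "X div 2 ^ k \<le> X" by simp
  ultimately have "a < Suc X" by linarith
  moreover have "(a + a + 1) * 2 ^ k + X mod 2 ^ k = X"
    using div_mult_mod_eq[of X "2 ^ k"] a by (simp add: mult_2)
  moreover have "X mod 2 ^ k < 2 ^ k" by simp
  ultimately show "\<exists>a<Suc X. \<exists>b<2 ^ k. (a + a + 1) * 2 ^ k + b = X" by blast
next
  assume "\<exists>a<Suc X. \<exists>b<2 ^ k. (a + a + 1) * 2 ^ k + b = X"
  then obtain a b where b: "b < 2 ^ k" and X: "X = b + (a + a + 1) * 2 ^ k"
    by (metis add.commute)
  have "X div 2 ^ k = a + a + 1"
    unfolding X using b by (subst div_mult_self1) auto
  then show "k \<in> set_decode X" by (simp add: set_decode_def)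
qed

lemma bitR [simp]: "ev bitR [k, X] = of_bool (k \<in> set_decode X)" "arity bitR (Suc (Suc 0))"
  by (auto simp: bitR_def mem_set_decode_iff[of k X])

abbreviation fstT where "fstT t \<equiv> Comp fstR [t]"
abbreviation sndT where "sndT t \<equiv> Comp sndR [t]"
abbreviation bitT (infix "\<epsilon>" 55) where "s \<epsilon> t \<equiv> Comp bitR [s, t]"

section \<open>The decision program\<close>

text \<open>Guards are evaluated on regions: the constant \<open>c\<close> is region \<open>4 * c\<close>, the parameter is
  region \<open>2 * m - 2\<close>. Addition instead of truncated subtraction makes \<open>m = 0\<close> a negative parameter.\<close>

primrec asat :: "nat \<Rightarrow> nat \<Rightarrow> ('x, 'p) clock_constraint \<Rightarrow> bool" where
  "asat m r (LessConst x c) \<longleftrightarrow> r < 4 * c"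
| "asat m r (EqConst x c) \<longleftrightarrow> r = 4 * c"
| "asat m r (LessParam x \<mu>) \<longleftrightarrow> r + 2 < 2 * m"
| "asat m r (EqParam x \<mu>) \<longleftrightarrow> r + 2 = 2 * m"
| "asat m r (Neg \<gamma>) \<longleftrightarrow> \<not> asat m r \<gamma>"
| "asat m r (Conj \<gamma> \<gamma>') \<longleftrightarrow> asat m r \<gamma> \<and> asat m r \<gamma>'"

text \<open>Truth of the constraint with code \<open>k\<close> at region \<open>w\<close>, given the set \<open>D\<close> of the codes of the
  true constraints below \<open>k\<close>. The program \<open>satR\<close> guesses \<open>D\<close>, which avoids course-of-values recursion.\<close>

definition local_sat :: "nat \<Rightarrow> nat \<Rightarrow> nat \<Rightarrow> nat set \<Rightarrow> bool" where
  "local_sat m w k D \<longleftrightarrow>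
     tag k = 0 \<and> w < 4 * arg (arg k) \<or>
     tag k = 1 \<and> w = 4 * arg (arg k) \<or>
     tag k = 2 \<and> w + 2 < 2 * m \<or>
     tag k = 3 \<and> w + 2 = 2 * m \<or>
     tag k = 4 \<and> arg k \<notin> D \<or>
     tag k = 5 \<and> tag (arg k) \<in> D \<and> arg (arg k) \<in> D"

text \<open>\<open>D\<close> is consulted only for tags 4 and 5 and only at subcodes, which lie
  below \<open>k\<close> by \<open>arg_less\<close>. So the local conditions amount to a recursion
  on codes.\<close>

lemma local_sat_cong:
  assumes "\<And>j. j < k \<Longrightarrow> j \<in> D \<longleftrightarrow> j \<in> D'"
  shows "local_sat m w k D \<longleftrightarrow> local_sat m w k D'"
proof (cases "0 < tag k")
  case True
  then have "arg k < k" by (rule arg_less)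
  then have "tag (arg k) < k" "arg (arg k) < k"
    using tag_le[of "arg k"] arg_le[of "arg k"] by linarith+
  with \<open>arg k < k\<close> show ?thesis using assms by (simp add: local_sat_def)
qed (simp add: local_sat_def)

lemma local_sat_ex: "\<exists>D\<subseteq>{..<n}. \<forall>k<n. k \<in> D \<longleftrightarrow> local_sat m w k D"
proof (induction n)
  case (Suc n)
  then obtain D where D: "D \<subseteq> {..<n}" "\<forall>k<n. k \<in> D \<longleftrightarrow> local_sat m w k D" by blast
  let ?D = "D \<union> {k. k = n \<and> local_sat m w n D}"
  have eq: "local_sat m w k ?D \<longleftrightarrow> local_sat m w k D" if "k \<le> n" for k
    using that by (intro local_sat_cong) auto
  have "?D \<subseteq> {..<Suc n}" "\<forall>k<Suc n. k \<in> ?D \<longleftrightarrow> local_sat m w k ?D"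
    using D eq by (auto simp: less_Suc_eq)
  then show ?case by blast
qed auto

text \<open>Makes the guess harmless: subformulas have smaller codes, so by induction every locally
  correct set agrees with \<open>asat\<close> on the codes of constraints.\<close>

lemma local_sat_unique:
  assumes "\<forall>k<n. k \<in> D \<longleftrightarrow> local_sat m w k D" "cc_encode \<gamma> < n"
  shows "cc_encode \<gamma> \<in> D \<longleftrightarrow> asat m w \<gamma>"
  using assms(2)
proof (induction \<gamma>)
  case (Neg \<gamma>)
  have "cc_encode \<gamma> < cc_encode (Neg \<gamma>)"
    using arg_less[of "cc_encode (Neg \<gamma>)"] by simp
  then show ?case using Neg assms(1) by (simp add: local_sat_def)
next
  case (Conj \<gamma> \<gamma>')
  have "cc_encode \<gamma> < cc_encode (Conj \<gamma> \<gamma>')" "cc_encode \<gamma>' < cc_encode (Conj \<gamma> \<gamma>')"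
    using arg_less[of "cc_encode (Conj \<gamma> \<gamma>')"] le_prod_encode_1[of "cc_encode \<gamma>" "cc_encode \<gamma>'"]
      le_prod_encode_2[of "cc_encode \<gamma>'" "cc_encode \<gamma>"]
    by simp_all
  then show ?case using Conj assms(1) by (simp add: local_sat_def)
qed (use assms(1) in \<open>simp_all add: local_sat_def\<close>)

lemma set_encode_less: "D \<subseteq> {..<n} \<Longrightarrow> set_encode D < 2 ^ n"
proof -
  assume D: "D \<subseteq> {..<n}"
  then have "set_encode D \<le> set_encode {..<n}"
    by (intro subset_decode_imp_le) (simp add: finite_subset)
  also have "\<dots> < 2 ^ n"
    by (induction n) (auto simp: lessThan_Suc)
  finally show ?thesis .
qed

lemma power_le_if_mem_set_decode: "k \<in> set_decode X \<Longrightarrow> 2 ^ k \<le> X"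
  by (metis (mono_tags) CollectD div_less even_zero linorder_not_less set_decode_def)

lemma mem_set_decode_le: "k \<in> set_decode X \<Longrightarrow> k \<le> X"
  using power_le_if_mem_set_decode[of k X] less_exp[of k] by linarith

text \<open>Turns quantification over subsets of an initial segment into bounded quantification over
  numbers, the only kind that \<open>ExT\<close> and \<open>AllT\<close> express.\<close>

lemma ex_code_iff: "(\<exists>X<2 ^ n. P (set_decode X)) \<longleftrightarrow> (\<exists>D\<subseteq>{..<n}. P D)"
proof
  assume "\<exists>D\<subseteq>{..<n}. P D"
  then obtain D where "D \<subseteq> {..<n}" "P D" by blast
  then show "\<exists>X<2 ^ n. P (set_decode X)"
    by (intro exI[of _ "set_encode D"]) (simp add: set_encode_less finite_subset)
next
  assume "\<exists>X<2 ^ n. P (set_decode X)"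
  then obtain X where X: "X < 2 ^ n" "P (set_decode X)" by blast
  have "set_decode X \<subseteq> {..<n}"
  proof
    fix k assume "k \<in> set_decode X"
    then have "2 ^ k \<le> X" by (rule power_le_if_mem_set_decode)
    with X(1) show "k \<in> {..<n}"
      by (metis lessThan_iff linorder_not_less order.strict_trans2 power_increasing one_le_numeral)
  qed
  with X(2) show "\<exists>D\<subseteq>{..<n}. P D" by blast
qed

abbreviation SucT where "SucT s \<equiv> Comp Succ [s]"

text \<open>Runs inside the two quantifiers of \<open>satR\<close>: position 0 is the code under
  test, 1 the guessed set, 3 the region and 4 the parameter code. Position 2 holds the whole
  guard.\<close>

definition local_satR :: recf where
  "local_satR =
     (let k = Proj 0; X = Proj 1; w = Proj 3; m = Proj 4 in
       ((fstT k \<approx> constR 0) \<sqinter> (w \<prec> constR 4 \<otimes> sndT (sndT k))) \<squnion>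
       ((fstT k \<approx> constR 1) \<sqinter> (w \<approx> constR 4 \<otimes> sndT (sndT k))) \<squnion>
       ((fstT k \<approx> constR 2) \<sqinter> (w \<oplus> constR 2 \<prec> constR 2 \<otimes> m)) \<squnion>
       ((fstT k \<approx> constR 3) \<sqinter> (w \<oplus> constR 2 \<approx> constR 2 \<otimes> m)) \<squnion>
       ((fstT k \<approx> constR 4) \<sqinter> \<sim> (sndT k \<epsilon> X)) \<squnion>
       ((fstT k \<approx> constR 5) \<sqinter> (fstT (sndT k) \<epsilon> X) \<sqinter> (sndT (sndT k) \<epsilon> X)))"

lemma ev_local_satR [simp]:
  "ev local_satR [k, X, g, w, m] = of_bool (local_sat m w k (set_decode X))"
  apply (simp only: local_satR_def Let_def local_sat_def ev.simps list.map OrT AndT NotT EqualT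
      LessT arith_ev constR fstR sndR bitR nth_Cons_0 of_bool_eq_0_iff not_not)
  by (intro arg_cong[where f = of_bool] disj_cong conj_cong refl) simp_all

lemma arity_local_satR [simp]: "arity local_satR 5"
  by (simp add: local_satR_def Let_def)

definition satR :: recf where
  "satR = ExT 3 (Pow2T (SucT (Proj 0))) ((Proj 1 \<epsilon> Proj 0) \<sqinter>
     AllT 4 (SucT (Proj 1)) ((Proj 0 \<epsilon> Proj 1) \<triangleq> local_satR))"

lemma arity_satR [simp]: "arity satR (Suc (Suc (Suc 0)))"
  by (simp add: satR_def Let_def)

lemma ev_satR [simp]: "ev satR [cc_encode \<gamma>, w, m] = of_bool (asat m w \<gamma>)"
proof -
  let ?g = "cc_encode \<gamma>"
  define consistent where
    "consistent D \<longleftrightarrow> (\<forall>k<Suc ?g. k \<in> D \<longleftrightarrow> local_sat m w k D)" for D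
  have "ev satR [?g, w, m] =
      of_bool (\<exists>X<2 ^ Suc ?g. ?g \<in> set_decode X \<and> consistent (set_decode X))"
    by (simp add: satR_def consistent_def)
  moreover have "(\<exists>X<2 ^ Suc ?g. ?g \<in> set_decode X \<and> consistent (set_decode X)) \<longleftrightarrow>
      (\<exists>D\<subseteq>{..<Suc ?g}. ?g \<in> D \<and> consistent D)"
    by (rule ex_code_iff)
  moreover have "?g \<in> D \<longleftrightarrow> asat m w \<gamma>" if "consistent D" for D
    using that unfolding consistent_def by (rule local_sat_unique) simp
  moreover obtain D where "D \<subseteq> {..<Suc ?g}" "consistent D"
    using local_sat_ex[of "Suc ?g" m w] unfolding consistent_def by blast
  ultimately show ?thesis by auto
qed

text \<open>Nodes of the region graph pair a state up to \<open>n\<close> with a region up to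
  \<open>4 * n + 3\<close>, and the code of \<open>(q, l)\<close> is below
  \<open>(q + l + 1) * (q + l + 1)\<close>.\<close>

definition size_bound :: "nat \<Rightarrow> nat" where
  "size_bound n = (5 * n + 5) * (5 * n + 5)"

text \<open>Guessing the region as \<open>2 * h + e\<close> supplies its half without division. The
  empty reset set has code 0, so the negated code is a factor 1 without a reset and 0 with one. The
  target \<open>v\<close> precedes the source \<open>u\<close> because callers quantify it
  innermost.\<close>

definition edgeR :: recf where
  "edgeR =
     ExT 4 (SucT (Proj 3)) (ExT 5 (constR 2 \<otimes> Proj 4 \<oplus> constR 2) (ExT 6 (constR 2)
       (let e = Proj 0; h = Proj 1; t = Proj 2; v = Proj 3; u = Proj 4; m = Proj 5; n = Proj 6;
            w = constR 2 \<otimes> h \<oplus> e in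
        (t \<epsilon> fstT (sndT (sndT (sndT n)))) \<sqinter>
        (fstT u \<approx> fstT t) \<sqinter> (fstT v \<approx> fstT (sndT t)) \<sqinter> (sndT u \<preceq> w) \<sqinter>
        Comp satR [fstT (sndT (sndT t)), w, m] \<sqinter>
        (sndT v \<approx> constR 2 \<otimes> h \<otimes> (\<sim> (sndT (sndT (sndT (sndT t))))) \<oplus> constR 1))))"

lemma arity_edgeR [simp]: "arity edgeR (Suc (Suc (Suc (Suc 0))))"
  by (simp add: edgeR_def Let_def)

definition boundR :: recf where
  "boundR = (constR 5 \<otimes> Proj 0 \<oplus> constR 5) \<otimes> (constR 5 \<otimes> Proj 0 \<oplus> constR 5)"

lemma boundR [simp]: "ev boundR [n] = size_bound n" "arity boundR (Suc 0)"
  by (simp_all add: boundR_def size_bound_def)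

text \<open>Reachability quantifies over the sets \<open>X\<close> closed under the edges; this avoids coding paths.\<close>

definition reachR :: recf where
  "reachR = AllT 4 (Pow2T (Comp boundR [Proj 3]))
     (let X = Proj 0; t = Proj 1; s = Proj 2; n = Proj 4 in
      (\<sim> (s \<epsilon> X)) \<squnion> (t \<epsilon> X) \<squnion>
      ExT 5 (Comp boundR [Proj 4]) (ExT 6 (Comp boundR [Proj 5])
        (let v = Proj 0; u = Proj 1; X = Proj 2; m = Proj 5; n = Proj 6 in
         (u \<epsilon> X) \<sqinter> Comp edgeR [v, u, m, n] \<sqinter> \<sim> (v \<epsilon> X))))"

lemma arity_reachR [simp]: "arity reachR (Suc (Suc (Suc (Suc 0))))"
  by (simp add: reachR_def Let_def)

definition bounded_edges :: "nat \<Rightarrow> nat \<Rightarrow> nat rel" where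
  "bounded_edges m n = {(u, v). u < size_bound n \<and> v < size_bound n \<and> ev edgeR [v, u, m, n] \<noteq> 0}"

text \<open>The set of nodes reachable from \<open>s\<close> is itself closed and stays in
  \<open>V\<close>, so it is one of the sets tested.\<close>

lemma rtrancl_iff_closed:
  assumes "E \<subseteq> V \<times> V" "s \<in> V"
  shows "(s, t) \<in> E\<^sup>* \<longleftrightarrow> (\<forall>X\<subseteq>V. s \<in> X \<and> (\<forall>u v. u \<in> X \<and> (u, v) \<in> E \<longrightarrow> v \<in> X) \<longrightarrow> t \<in> X)"
    (is "_ \<longleftrightarrow> ?R")
proof
  assume "(s, t) \<in> E\<^sup>*"
  then show ?R by (induction rule: rtrancl_induct) blast+
next
  assume ?R
  moreover have "E\<^sup>* `` {s} \<subseteq> V"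
  proof
    fix x assume "x \<in> E\<^sup>* `` {s}"
    then have "(s, x) \<in> E\<^sup>*" by simp
    then show "x \<in> V" using assms by cases auto
  qed
  ultimately have "t \<in> E\<^sup>* `` {s}" by (blast intro: rtrancl_into_rtrancl)
  then show "(s, t) \<in> E\<^sup>*" by simp
qed

text \<open>The bound on \<open>s\<close> matters: a larger \<open>s\<close> belongs to none of the
  sets tested, and the program would answer 1 for every \<open>t\<close>.\<close>

lemma ev_reachR [simp]:
  assumes "s < size_bound n"
  shows "ev reachR [t, s, m, n] = of_bool ((s, t) \<in> (bounded_edges m n)\<^sup>*)"
proof -
  let ?B = "size_bound n" and ?E = "bounded_edges m n"
  define escapes where "escapes X \<longleftrightarrow>
    (\<exists>u<?B. \<exists>v<?B. u \<in> X \<and> ev edgeR [v, u, m, n] \<noteq> 0 \<and> v \<notin> X)" for X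
  define separates where "separates X \<longleftrightarrow> s \<in> X \<and> t \<notin> X \<and> \<not> escapes X" for X
  have "ev reachR [t, s, m, n] = of_bool (\<forall>X<2 ^ ?B. \<not> separates (set_decode X))"
    unfolding separates_def escapes_def by (simp add: reachR_def Let_def)
  also have "(\<forall>X<2 ^ ?B. \<not> separates (set_decode X)) \<longleftrightarrow> (\<forall>X\<subseteq>{..<?B}. \<not> separates X)"
    using ex_code_iff[of ?B separates] by blast
  also have "\<dots> \<longleftrightarrow> (s, t) \<in> ?E\<^sup>*"
  proof -
    have "escapes X \<longleftrightarrow> \<not> (\<forall>u v. u \<in> X \<and> (u, v) \<in> ?E \<longrightarrow> v \<in> X)" for X
      by (auto simp: bounded_edges_def escapes_def)
    then have "\<not> separates X \<longleftrightarrow>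
        (s \<in> X \<and> (\<forall>u v. u \<in> X \<and> (u, v) \<in> ?E \<longrightarrow> v \<in> X) \<longrightarrow> t \<in> X)" for X
      unfolding separates_def by blast
    moreover have "?E \<subseteq> {..<?B} \<times> {..<?B}" "s \<in> {..<?B}"
      using assms by (auto simp: bounded_edges_def)
    ultimately show ?thesis
      by (simp only: rtrancl_iff_closed[of ?E "{..<?B}" s t])
  qed
  finally show ?thesis .
qed

text \<open>The codes \<open>m\<close> up to \<open>2 * n + 2\<close> stand for a negative parameter
  and for the \<open>2 * n + 2\<close> positions. An edge from \<open>u\<close> to \<open>v\<close>
  with a path back is a cycle of positive length, and \<open>triangle q + q\<close> is the code of
  \<open>(q, 0)\<close>.\<close>

definition emptyR :: recf where
  "emptyR = \<sim> (ExT 1 (constR 2 \<otimes> Proj 0 \<oplus> constR 3)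
     (ExT 2 (Comp boundR [Proj 1]) (ExT 3 (Comp boundR [Proj 2])
       (let v = Proj 0; u = Proj 1; m = Proj 2; n = Proj 3;
            r = sndT (sndT (sndT (sndT n))) in
        (fstT u \<epsilon> fstT (sndT r)) \<sqinter>
        Comp reachR [u, Comp triangleR [fstT r] \<oplus> fstT r, m, n] \<sqinter>
        Comp edgeR [v, u, m, n] \<sqinter> Comp reachR [u, v, m, n]))))"

section \<open>Regions of a single clock\<close>

locale positions =
  fixes P :: "nat \<Rightarrow> real" and L :: nat
  assumes P_0: "P 0 = 0" and P_strict: "i < j \<Longrightarrow> j \<le> L \<Longrightarrow> P i < P j"
begin

lemma P_less_iff: "i \<le> L \<Longrightarrow> j \<le> L \<Longrightarrow> P i < P j \<longleftrightarrow> i < j"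
  by (metis P_strict linorder_neqE_nat order_less_asym order_less_irrefl)

lemma P_le_iff: "i \<le> L \<Longrightarrow> j \<le> L \<Longrightarrow> P i \<le> P j \<longleftrightarrow> i \<le> j"
  by (metis P_less_iff linorder_not_less)

text \<open>At \<open>P j\<close> the two counts are \<open>j\<close> and \<open>j + 1\<close>, in
  the gap after it both are \<open>j + 1\<close>; subtracting 1 gives \<open>2 * j\<close> and
  \<open>2 * j + 1\<close>. Counting makes monotonicity immediate.\<close>

definition region :: "real \<Rightarrow> nat" where
  "region v = card {i. i \<le> L \<and> P i < v} + card {i. i \<le> L \<and> P i \<le> v} - 1"

lemma region_mono: "v \<le> w \<Longrightarrow> region v \<le> region w"
  unfolding region_def by (intro diff_le_mono add_mono card_mono) auto

lemma region_point: "j \<le> L \<Longrightarrow> region (P j) = 2 * j"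
proof -
  assume j: "j \<le> L"
  have "{i. i \<le> L \<and> P i < P j} = {..<j}" "{i. i \<le> L \<and> P i \<le> P j} = {..j}"
    using j by (auto simp: P_less_iff P_le_iff)
  then show ?thesis by (simp add: region_def)
qed

lemma region_between:
  assumes "j \<le> L" "P j < v" "j < L \<Longrightarrow> v < P (Suc j)"
  shows "region v = 2 * j + 1"
proof -
  have *: "P i \<le> v \<longleftrightarrow> i \<le> j" "P i < v \<longleftrightarrow> i \<le> j" if "i \<le> L" for i
  proof -
    have "P i < v" if "i \<le> j"
      using P_le_iff[of i j] assms(1,2) that \<open>i \<le> L\<close> by linarith
    moreover have "v < P i" if "j < i"
      using P_le_iff[of "Suc j" i] assms(3) that \<open>i \<le> L\<close> by linarith
    ultimately show "P i \<le> v \<longleftrightarrow> i \<le> j" "P i < v \<longleftrightarrow> i \<le> j" by force+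
  qed
  have "{i. i \<le> L \<and> P i < v} = {..j}" "{i. i \<le> L \<and> P i \<le> v} = {..j}"
    using * assms(1) by auto
  then show ?thesis by (simp add: region_def)
qed

lemma region_cases:
  assumes "0 \<le> v"
  obtains j where "j \<le> L" "v = P j"
  | j where "j \<le> L" "P j < v" "j < L \<Longrightarrow> v < P (Suc j)"
proof -
  let ?M = "{i. i \<le> L \<and> P i \<le> v}"
  have fin: "finite ?M" and "0 \<in> ?M" using assms by (auto simp: P_0)
  then have "Max ?M \<in> ?M" by (intro Max_in) auto
  moreover have "v < P (Suc (Max ?M))" if "Max ?M < L"
  proof (rule ccontr)
    assume "\<not> v < P (Suc (Max ?M))"
    with that have "Suc (Max ?M) \<in> ?M" by auto
    from Max_ge[OF fin this] show False by (simp only: Suc_n_not_le_n)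
  qed
  ultimately show thesis using that[of "Max ?M"] by force
qed

lemma region_le: "0 \<le> v \<Longrightarrow> region v \<le> 2 * L + 1"
  by (erule region_cases) (auto simp: region_point region_between)

lemma region_eq_point_iff:
  assumes "0 \<le> v" "j \<le> L"
  shows "region v = 2 * j \<longleftrightarrow> v = P j"
  using assms(1)
proof (cases rule: region_cases)
  case (1 i)
  then show ?thesis using assms(2) P_less_iff[of i j] P_less_iff[of j i]
    by (auto simp: region_point)
next
  case (2 i)
  then have "region v = 2 * i + 1" by (rule region_between)
  then have "region v \<noteq> 2 * j" by presburger
  then show ?thesis using region_point[OF assms(2)] by auto
qed

lemma region_less_point_iff:
  assumes "0 \<le> v" "j \<le> L"
  shows "region v < 2 * j \<longleftrightarrow> v < P j"
proof
  assume "region v < 2 * j"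
  then show "v < P j"
    using region_mono[of "P j" v] by (force simp: region_point[OF assms(2)])
next
  assume "v < P j"
  then show "region v < 2 * j"
    using region_mono[of v "P j"] region_eq_point_iff[OF assms]
    by (force simp: region_point[OF assms(2)])
qed

text \<open>For a clock value in region \<open>r\<close>, the regions that a positive delay can reach are those from
  \<open>2 * (r div 2) + 1\<close> on: an open (odd) region need not be left, a point (even) region must be.\<close>

lemma region_after_delay:
  assumes "0 \<le> v" "v < w"
  shows "2 * (region v div 2) + 1 \<le> region w"
  using assms(1)
proof (cases rule: region_cases)
  case (1 j)
  have "region w \<noteq> 2 * j" using 1 assms region_eq_point_iff[of w j] by simp
  moreover have "2 * j \<le> region w" using region_mono[of v w] assms 1 by (simp add: region_point)
  ultimately show ?thesis using 1 by (simp add: region_point)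
next
  case (2 j)
  then have "region v = 2 * j + 1" by (rule region_between)
  then show ?thesis using region_mono[of v w] assms(2) by simp
qed

lemma delay_to_region:
  assumes "0 \<le> v" "2 * (region v div 2) + 1 \<le> r" "r \<le> 2 * L + 1"
  obtains w where "v < w" "region w = r"
proof (cases "even r")
  case True
  then obtain j where j: "r = 2 * j" by blast
  with assms have "j \<le> L" "region v < 2 * j" by presburger+
  then show thesis
    using that[of "P j"] region_less_point_iff[OF assms(1), of j] j by (simp add: region_point)
next
  case False
  then obtain j where j: "r = 2 * j + 1" by (elim oddE)
  with assms have jL: "j \<le> L" and less: "region v < 2 * Suc j" by presburger+
  \<comment> \<open>The new value must exceed both the old one and the left end of the gap; as the
    gap is open, there is room however late the old value lies in it.\<close>
  let ?u = "max v (P j)"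
  show thesis
  proof (cases "j < L")
    case True
    then have "v < P (Suc j)" "P j < P (Suc j)"
      using region_less_point_iff[OF assms(1), of "Suc j"] less by (auto simp: P_less_iff)
    then have "?u < P (Suc j)" by simp
    then obtain w where w: "?u < w" "w < P (Suc j)" using dense by blast
    then have "region w = r" unfolding j by (intro region_between jL) auto
    then show thesis using that[of w] w by simp
  next
    case False
    have "region (?u + 1) = r" unfolding j using False by (intro region_between jL) auto
    then show thesis using that[of "?u + 1"] by simp
  qed
qed

lemma region_0: "region 0 = 0"
  using region_point[of 0] by (simp add: P_0)

text \<open>Serves the first step, where the clock is 0 and the delay may be 0, so that every region
  can be reached.\<close>

lemma region_surj:
  assumes "r \<le> 2 * L + 1"
  obtains w where "0 \<le> w" "region w = r"
proof (cases r)
  case 0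
  then show thesis using that[of 0] region_0 by simp
next
  case (Suc k)
  obtain w where "0 < w" "region w = r"
    by (rule delay_to_region[of 0 r]) (use Suc assms in \<open>simp_all add: region_0\<close>)
  then show thesis using that[of w] by simp
qed

end

text \<open>The positions are the constants up to \<open>K\<close> and one point strictly between (or beyond) them,
  which is the parameter whenever that is possible. Parameter code 0 stands for all negative
  values, code \<open>Suc j\<close> for the value \<open>P j\<close>.\<close>

locale parameter_positions = positions +
  fixes K :: nat and \<mu> :: real and m :: nat
  assumes L_eq: "L = 2 * K + 1"
    and P_even: "c \<le> K \<Longrightarrow> P (2 * c) = real c"
    and code: "m = 0 \<and> \<mu> < 0 \<or> (\<exists>j\<le>L. m = Suc j \<and> P j = \<mu>)"
begin

text \<open>The code of a guard dominates its constants, so each constant \<open>c\<close> is the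
  position \<open>2 * c\<close>, with region \<open>4 * c\<close>. A non-negative clock value is
  neither below nor equal to a negative parameter, which matches the atoms at
  \<open>m = 0\<close>.\<close>

lemma asat_region:
  assumes "0 \<le> v x" "I p = \<mu>"
  shows "cc_encode \<gamma> \<le> K \<Longrightarrow> cc_clocks \<gamma> \<subseteq> {x} \<Longrightarrow> cc_params \<gamma> \<subseteq> {p} \<Longrightarrow>
    asat m (region (v x)) \<gamma> \<longleftrightarrow> sat v I \<gamma>"
proof (induction \<gamma>)
  case (LessConst y c)
  then have "c \<le> K"
    using le_prod_encode_2[of c y] le_prod_encode_2[of "prod_encode (y, c)" 0] by simp
  then show ?case
    using region_less_point_iff[OF assms(1), of "2 * c"] P_even LessConst L_eq by simp
next
  case (EqConst y c)
  then have "c \<le> K"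
    using le_prod_encode_2[of c y] le_prod_encode_2[of "prod_encode (y, c)" 1] by simp
  then show ?case
    using region_eq_point_iff[OF assms(1), of "2 * c"] P_even EqConst L_eq by simp
next
  case (LessParam y q)
  from code show ?case
  proof (elim disjE exE conjE)
    fix j assume "j \<le> L" "m = Suc j" "P j = \<mu>"
    then show ?thesis
      using region_less_point_iff[OF assms(1), of j] LessParam assms(2) by auto
  qed (use LessParam assms in auto)
next
  case (EqParam y q)
  from code show ?case
  proof (elim disjE exE conjE)
    fix j assume "j \<le> L" "m = Suc j" "P j = \<mu>"
    then show ?thesis
      using region_eq_point_iff[OF assms(1), of j] EqParam assms(2) by auto
  qed (use EqParam assms in auto)
next
  case (Neg \<gamma>)
  then show ?case using le_prod_encode_2[of "cc_encode \<gamma>" 4] by simp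
next
  case (Conj \<gamma> \<gamma>')
  then show ?case
    using le_prod_encode_2[of "prod_encode (cc_encode \<gamma>, cc_encode \<gamma>')" 5]
      le_prod_encode_1[of "cc_encode \<gamma>" "cc_encode \<gamma>'"]
      le_prod_encode_2[of "cc_encode \<gamma>'" "cc_encode \<gamma>"]
    by simp
qed

end

lemma parameter_positions_ex:
  fixes \<mu> :: real and K :: nat
  obtains P m where "m < 2 * K + 3" "parameter_positions P (2 * K + 1) K \<mu> m"
proof -
  \<comment> \<open>The point chosen in the gap after \<open>c\<close> is the parameter if it lies
    there, otherwise the midpoint. The last gap has no upper end, so every parameter beyond
    \<open>K\<close> belongs to it.\<close>
  define mid where "mid c = (if real c < \<mu> \<and> (\<mu> < real c + 1 \<or> c = K) then \<mu> else real c + 1/2)" for c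
  define P where "P j = (if even j then real (j div 2) else mid (j div 2))" for j
  have mid: "real c < mid c" "c < K \<Longrightarrow> mid c < real c + 1" for c
    by (auto simp: mid_def)
  have step: "P j < P (Suc j)" if "j < 2 * K + 1" for j
  proof (cases "even j")
    case True
    then show ?thesis by (simp add: P_def mid)
  next
    case False
    then obtain c where "j = 2 * c + 1" by (elim oddE)
    with that show ?thesis using mid(2)[of c] by (simp add: P_def)
  qed
  have strict: "P i < P j" if "i < j" "j \<le> 2 * K + 1" for i j
    using that
  proof (induction j)
    case (Suc j)
    then show ?case using step[of j] by (cases "i = j") auto
  qed auto
  show thesis
  proof (cases "\<mu> < 0")
    case True
    have "parameter_positions P (2 * K + 1) K \<mu> 0"
      by unfold_locales (use True strict in \<open>auto simp: P_def\<close>)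
    then show thesis using that[of 0] by simp
  next
    case False
    have "\<exists>j\<le>2 * K + 1. P j = \<mu>"
    proof -
      \<comment> \<open>The integer part locates the parameter; the cap at \<open>K\<close> sends
        everything beyond \<open>K\<close> to the last gap.\<close>
      define c where "c = min K (nat \<lfloor>\<mu>\<rfloor>)"
      have c: "c \<le> K" "real c \<le> \<mu>" "\<mu> < real c + 1 \<or> c = K"
        using False unfolding c_def by linarith+
      show ?thesis
      proof (cases "\<mu> = real c")
        case True
        then show ?thesis using c by (intro exI[of _ "2 * c"]) (simp add: P_def)
      next
        case False
        then show ?thesis using c by (intro exI[of _ "2 * c + 1"]) (simp add: P_def mid_def)
      qed
    qed
    then obtain j where j: "j \<le> 2 * K + 1" "P j = \<mu>" by blast
    have "parameter_positions P (2 * K + 1) K \<mu> (Suc j)"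
      by unfold_locales (use j strict in \<open>auto simp: P_def\<close>)
    then show thesis using that[of "Suc j"] j by simp
  qed
qed

text \<open>The converse direction: every parameter code is realised by an actual value, namely -1
  or a multiple of 1/2.\<close>

lemma half_integer_positions:
  assumes "m < 2 * K + 3"
  shows "parameter_positions (\<lambda>j. real j / 2) (2 * K + 1) K (if m = 0 then -1 else real (m - 1) / 2) m"
proof unfold_locales
  show "m = 0 \<and> (if m = 0 then -1 else real (m - 1) / 2) < 0 \<or>
      (\<exists>j\<le>2 * K + 1. m = Suc j \<and> real j / 2 = (if m = 0 then -1 else real (m - 1) / 2))"
    using assms by (cases m) auto
qed auto

section \<open>The region graph\<close>

text \<open>A node \<open>(q, l)\<close> records the least region \<open>l\<close> in which the clock can be tested next. Initially
  it is 0, because the first time stamp may be 0.\<close>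

definition edges :: "nat \<Rightarrow> nat \<Rightarrow> ('a, 'q, 'x, 'p) pta \<Rightarrow> ('q \<times> nat) rel" where
  "edges m K A = {((q, l), (q', l')). \<exists>\<gamma> a S h e. (q, q', \<gamma>, a, S) \<in> transitions A \<and>
     h < 2 * K + 2 \<and> e < 2 \<and> l \<le> 2 * h + e \<and> asat m (2 * h + e) \<gamma> \<and>
     l' = (if S = {} then 2 * h + 1 else 1)}"

definition recurrent_path :: "'v rel \<Rightarrow> 'v \<Rightarrow> ('v \<Rightarrow> 'b) \<Rightarrow> 'b set \<Rightarrow> (nat \<Rightarrow> 'v) \<Rightarrow> bool" where
  "recurrent_path E s label F f \<longleftrightarrow>
     f 0 = s \<and> (\<forall>i. (f i, f (Suc i)) \<in> E) \<and> (\<exists>q\<in>F. infinite {i. label (f i) = q})"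

text \<open>Forwards, some node with the recurring label must repeat because there are finitely many
  nodes; backwards, the cycle is traversed forever after the stem.\<close>

lemma recurrent_path_iff_lasso:
  assumes "E \<subseteq> V \<times> V" "finite V"
  shows "(\<exists>f. recurrent_path E s label F f) \<longleftrightarrow>
    (\<exists>b. label b \<in> F \<and> (s, b) \<in> E\<^sup>* \<and> (b, b) \<in> E\<^sup>+)"
proof
  assume "\<exists>f. recurrent_path E s label F f"
  then obtain f q where f: "f 0 = s" "\<And>i. (f i, f (Suc i)) \<in> E" and q: "q \<in> F"
    and inf: "infinite {i. label (f i) = q}"
    by (auto simp: recurrent_path_def)
  have "f i \<in> V" for i using f(2)[of i] assms(1) by blast
  then have "finite (f ` {i. label (f i) = q})"
    using finite_subset[OF _ assms(2)] by blast
  from pigeonhole_infinite[OF inf this] obtain i where i: "label (f i) = q"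
    and inf': "infinite {j. label (f j) = q \<and> f j = f i}" by auto
  then obtain j where j: "j > i" "f j = f i"
    by (metis (mono_tags, lifting) infinite_nat_iff_unbounded mem_Collect_eq)
  have path: "(f i, f (Suc (i + k))) \<in> E\<^sup>+" for i k
    by (induction k) (use f(2) in \<open>auto intro: trancl_into_trancl\<close>)
  have "(f i, f i) \<in> E\<^sup>+" using path[of i "j - Suc i"] j by simp
  moreover have "(s, f i) \<in> E\<^sup>*"
  proof (cases i)
    case 0
    then show ?thesis using f(1) by simp
  next
    case (Suc k)
    then show ?thesis using path[of 0 k] f(1) by (simp add: trancl_into_rtrancl)
  qed
  ultimately show "\<exists>b. label b \<in> F \<and> (s, b) \<in> E\<^sup>* \<and> (b, b) \<in> E\<^sup>+" using i q by blast
next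
  assume "\<exists>b. label b \<in> F \<and> (s, b) \<in> E\<^sup>* \<and> (b, b) \<in> E\<^sup>+"
  then obtain b k n where b: "label b \<in> F" "(s, b) \<in> E ^^ k" "(b, b) \<in> E ^^ n" "n > 0"
    by (auto simp: rtrancl_power trancl_power)
  then obtain p g where p: "p 0 = s" "p k = b" "\<forall>i<k. (p i, p (Suc i)) \<in> E"
    and g: "g 0 = b" "g n = b" "\<forall>i<n. (g i, g (Suc i)) \<in> E"
    unfolding relpow_fun_conv by blast
  \<comment> \<open>The stem \<open>p\<close> for \<open>k\<close> steps, then the cycle
    \<open>g\<close> read modulo its length. The pieces fit since \<open>p k\<close>,
    \<open>g 0\<close> and \<open>g n\<close> are all \<open>b\<close>.\<close>
  define f where "f i = (if i < k then p i else g ((i - k) mod n))" for i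
  have "f 0 = s" using p g by (cases "k = 0") (auto simp: f_def)
  moreover have "(f i, f (Suc i)) \<in> E" for i
  proof -
    consider "Suc i < k" | "Suc i = k" | "k \<le> i" by linarith
    then show ?thesis
    proof cases
      case 1
      then show ?thesis using p by (simp add: f_def)
    next
      case 2
      then show ?thesis using p(2) p(3)[rule_format, of i] g(1) by (simp add: f_def)
    next
      case 3
      have "(i - k) mod n < n" using b(4) by simp
      then have "(g ((i - k) mod n), g (Suc ((i - k) mod n))) \<in> E" using g(3) by blast
      then show ?thesis using 3 g(1,2) by (auto simp: f_def Suc_diff_le mod_Suc)
    qed
  qed
  moreover have "infinite {i. label (f i) = label b}"
    unfolding infinite_nat_iff_unbounded
  proof
    fix l
    have "l < k + n * Suc l" using b(4) by (cases n) auto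
    moreover have "f (k + n * Suc l) = b" using g(1) by (simp add: f_def del: mult_Suc_right)
    ultimately show "\<exists>i>l. i \<in> {i. label (f i) = label b}" by auto
  qed
  ultimately show "\<exists>f. recurrent_path E s label F f" using b(1) unfolding recurrent_path_def by blast
qed

section \<open>Correctness of the program\<close>

lemma prod_encode_less_size_bound:
  assumes "q \<le> n" "l \<le> 4 * n + 3"
  shows "prod_encode (q, l) < size_bound n"
proof -
  have triangle: "triangle k \<le> k * k" for k by (induction k) auto
  have "prod_encode (q, l) \<le> (q + l) * (q + l) + (q + l)"
    using triangle[of "q + l"] by (simp add: prod_encode_def)
  also have "\<dots> < (q + l + 1) * (q + l + 1)" by (simp add: algebra_simps)
  also have "\<dots> \<le> size_bound n"
    unfolding size_bound_def using assms by (intro mult_le_mono) auto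
  finally show ?thesis .
qed

lemma pta_encode_components:
  assumes "n = pta_encode A"
  shows "tag (arg (arg (arg n))) = set_encode (transition_encode ` transitions A)"
    "tag (arg (arg (arg (arg n)))) = initial A"
    "tag (arg (arg (arg (arg (arg n))))) = set_encode (buchi A)"
  unfolding assms by (simp_all add: pta_encode_def)

lemma pta_encode_bounds:
  assumes "is_pta A" and n: "n = pta_encode A"
  shows "q \<in> states A \<Longrightarrow> q \<le> n" "T \<in> transitions A \<Longrightarrow> transition_encode T \<le> n"
proof -
  have "tag (arg (arg n)) = set_encode (states A)"
    unfolding n by (simp add: pta_encode_def)
  moreover have "finite (states A)" "finite (transitions A)"
    using assms by (auto simp: is_pta_def)
  moreover have "tag (arg (arg n)) \<le> n" "tag (arg (arg (arg n))) \<le> n"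
    using tag_le[of "arg (arg n)"] tag_le[of "arg (arg (arg n))"] arg_le[of "arg (arg n)"]
      arg_le[of "arg n"] arg_le[of n] by linarith+
  ultimately show "q \<in> states A \<Longrightarrow> q \<le> n" "T \<in> transitions A \<Longrightarrow> transition_encode T \<le> n"
    using mem_set_decode_le[of q "tag (arg (arg n))"]
      mem_set_decode_le[of "transition_encode T" "tag (arg (arg (arg n)))"]
    by (auto simp: pta_encode_components[OF n])
qed

lemma transition_wf:
  assumes "is_pta A" "(q, q', \<gamma>, a, S) \<in> transitions A"
  shows "q \<in> states A" "q' \<in> states A" "cc_clocks \<gamma> \<subseteq> clocks A" "cc_params \<gamma> \<subseteq> params A"
    "a \<in> alphabet A" "S \<subseteq> clocks A" "finite S"
proof -
  have "(q, q', \<gamma>, a, S) \<in> states A \<times> states A \<times> clock_constraints (clocks A) (params A)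
       \<times> alphabet A \<times> Pow (clocks A)" and "finite (clocks A)"
    using assms unfolding is_pta_def by blast+
  then show "q \<in> states A" "q' \<in> states A" "cc_clocks \<gamma> \<subseteq> clocks A" "cc_params \<gamma> \<subseteq> params A"
    "a \<in> alphabet A" "S \<subseteq> clocks A" "finite S"
    by (auto simp: clock_constraints_def intro: finite_subset)
qed

text \<open>This is why the code of the automaton can serve as the bound \<open>K\<close> on the
  constants.\<close>

lemma guard_encode_le:
  assumes "is_pta A" "(q, q', \<gamma>, a, S) \<in> transitions A"
  shows "cc_encode \<gamma> \<le> pta_encode A"
proof -
  let ?t = "transition_encode (q, q', \<gamma>, a, S)"
  have "cc_encode \<gamma> = tag (arg (arg ?t))" by (simp add: transition_encode_def)
  also have "\<dots> \<le> ?t"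
    using tag_le[of "arg (arg ?t)"] arg_le[of "arg ?t"] arg_le[of ?t] by linarith
  also have "\<dots> \<le> pta_encode A" using pta_encode_bounds(2)[OF assms(1) refl assms(2)] .
  finally show ?thesis .
qed

lemma ev_edgeR:
  assumes A: "is_pta A" and n: "n = pta_encode A"
  shows "ev edgeR [v, u, m, n] = of_bool (((tag u, arg u), (tag v, arg v)) \<in> edges m n A)"
proof -
  define good where "good t h e \<longleftrightarrow> tag u = tag t \<and> tag v = tag (arg t) \<and> arg u \<le> 2 * h + e \<and>
     ev satR [tag (arg (arg t)), 2 * h + e, m] \<noteq> 0 \<and>
     arg v = 2 * h * of_bool (arg (arg (arg (arg t))) = 0) + 1" for t h e
  have "ev edgeR [v, u, m, n] = of_bool (\<exists>t<Suc n. \<exists>h<2 * n + 2. \<exists>e<2.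
     t \<in> set_decode (tag (arg (arg (arg n)))) \<and> good t h e)"
    by (simp add: edgeR_def Let_def good_def)
  also have "(\<exists>t<Suc n. \<exists>h<2 * n + 2. \<exists>e<2.
       t \<in> set_decode (tag (arg (arg (arg n)))) \<and> good t h e) \<longleftrightarrow>
     (\<exists>t\<in>transitions A. \<exists>h<2 * n + 2. \<exists>e<2. good (transition_encode t) h e)"
  proof -
    have "t \<in> set_decode (tag (arg (arg (arg n)))) \<longleftrightarrow> t \<in> transition_encode ` transitions A" for t
      using A by (simp add: pta_encode_components[OF n] is_pta_def)
    moreover have "transition_encode t < Suc n" if "t \<in> transitions A" for t
      using pta_encode_bounds(2)[OF A n that] by simp
    ultimately have "t < Suc n \<and> t \<in> set_decode (tag (arg (arg (arg n)))) \<longleftrightarrow>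
        t \<in> transition_encode ` transitions A" for t
      by blast
    note codes = this
    have "(\<exists>t<Suc n. \<exists>h<2 * n + 2. \<exists>e<2. t \<in> set_decode (tag (arg (arg (arg n)))) \<and> good t h e) \<longleftrightarrow>
        (\<exists>t. (t < Suc n \<and> t \<in> set_decode (tag (arg (arg (arg n))))) \<and>
          (\<exists>h<2 * n + 2. \<exists>e<2. good t h e))"
      by blast
    also have "\<dots> \<longleftrightarrow> (\<exists>t\<in>transitions A. \<exists>h<2 * n + 2. \<exists>e<2. good (transition_encode t) h e)"
      unfolding codes by blast
    finally show ?thesis .
  qed
  also have "\<dots> \<longleftrightarrow> ((tag u, arg u), (tag v, arg v)) \<in> edges m n A"
  proof -
    have "good (transition_encode (q, q', \<gamma>, a, S)) h e \<longleftrightarrow>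
        tag u = q \<and> tag v = q' \<and> arg u \<le> 2 * h + e \<and> asat m (2 * h + e) \<gamma> \<and>
        arg v = (if S = {} then 2 * h + 1 else 1)"
      if "(q, q', \<gamma>, a, S) \<in> transitions A" for q q' \<gamma> a S h e
    proof -
      \<comment> \<open>Finiteness of \<open>S\<close> matters: \<open>set_encode\<close> is 0 on
        infinite sets as well.\<close>
      have "set_encode S = 0 \<longleftrightarrow> S = {}"
        using set_encode_eq[of S "{}"] transition_wf(7)[OF A that] by simp
      then show ?thesis by (auto simp: good_def transition_encode_def)
    qed
    note good = this
    show ?thesis
    proof
      assume "\<exists>t\<in>transitions A. \<exists>h<2 * n + 2. \<exists>e<2. good (transition_encode t) h e"
      then obtain q q' \<gamma> a S h e where "(q, q', \<gamma>, a, S) \<in> transitions A" "h < 2 * n + 2" "e < 2"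
        "good (transition_encode (q, q', \<gamma>, a, S)) h e" by auto
      with good show "((tag u, arg u), (tag v, arg v)) \<in> edges m n A"
        unfolding edges_def by blast
    next
      assume "((tag u, arg u), (tag v, arg v)) \<in> edges m n A"
      then obtain \<gamma> a S h e where "(tag u, tag v, \<gamma>, a, S) \<in> transitions A" "h < 2 * n + 2"
        "e < 2" "arg u \<le> 2 * h + e" "asat m (2 * h + e) \<gamma>" "arg v = (if S = {} then 2 * h + 1 else 1)"
        unfolding edges_def by blast
      with good show "\<exists>t\<in>transitions A. \<exists>h<2 * n + 2. \<exists>e<2. good (transition_encode t) h e"
        by blast
    qed
  qed
  finally show ?thesis .
qed

lemma edges_subset:
  assumes "is_pta A"
  shows "edges m K A \<subseteq> (states A \<times> {..4 * K + 3}) \<times> (states A \<times> {..4 * K + 3})"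
proof
  fix z assume "z \<in> edges m K A"
  then obtain q l q' l' \<gamma> a S h e where "z = ((q, l), (q', l'))" "(q, q', \<gamma>, a, S) \<in> transitions A"
    "h < 2 * K + 2" "e < 2" "l \<le> 2 * h + e" "l' = (if S = {} then 2 * h + 1 else 1)"
    unfolding edges_def by blast
  then show "z \<in> (states A \<times> {..4 * K + 3}) \<times> (states A \<times> {..4 * K + 3})"
    using transition_wf(1,2)[OF assms] by (auto split: if_splits)
qed

text \<open>All nodes on edges of the region graph have codes below the bound, so cutting off there
  loses no edge.\<close>

lemma bounded_edges_eq:
  assumes "is_pta A" and "n = pta_encode A"
  shows "bounded_edges m n = inv_image (edges m n A) prod_decode"
proof -
  have bound: "u < size_bound n" if "prod_decode u \<in> states A \<times> {..4 * n + 3}" for u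
  proof -
    from that have "tag u \<le> n" "arg u \<le> 4 * n + 3"
      using pta_encode_bounds(1)[OF assms] by (auto simp: tag_def arg_def mem_Times_iff)
    then show ?thesis using prod_encode_less_size_bound[of "tag u" n "arg u"] by simp
  qed
  have "(u, v) \<in> bounded_edges m n \<longleftrightarrow> (prod_decode u, prod_decode v) \<in> edges m n A" for u v
    using bound[of u] bound[of v]
      subsetD[OF edges_subset[OF assms(1), of m n], of "(prod_decode u, prod_decode v)"]
    by (auto simp: bounded_edges_def ev_edgeR[OF assms] tag_def arg_def)
  then show ?thesis by auto
qed

text \<open>Surjectivity pulls the intermediate nodes of a path back; injectivity identifies its
  ends.\<close>

lemma rtrancl_inv_image_bij:
  assumes "bij f"
  shows "(u, v) \<in> (inv_image E f)\<^sup>* \<longleftrightarrow> (f u, f v) \<in> E\<^sup>*"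
proof
  assume "(u, v) \<in> (inv_image E f)\<^sup>*"
  then show "(f u, f v) \<in> E\<^sup>*"
    by (induction rule: rtrancl_induct) (auto intro: rtrancl_into_rtrancl)
next
  have "(inv f a, inv f b) \<in> (inv_image E f)\<^sup>*" if "(a, b) \<in> E\<^sup>*" for a b
    using that
  proof (induction rule: rtrancl_induct)
    case (step b c)
    have "(inv f b, inv f c) \<in> inv_image E f"
      using step(2) by (simp add: surj_f_inv_f[OF bij_is_surj[OF assms]])
    with step(3) show ?case by (rule rtrancl_into_rtrancl)
  qed simp
  moreover assume "(f u, f v) \<in> E\<^sup>*"
  ultimately have "(inv f (f u), inv f (f v)) \<in> (inv_image E f)\<^sup>*" by blast
  then show "(u, v) \<in> (inv_image E f)\<^sup>*" by (simp add: bij_is_inj[OF assms])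
qed

lemma emptyR_arity: "arity emptyR (Suc 0)"
  by (simp add: emptyR_def Let_def)

lemma ev_emptyR:
  assumes A: "is_pta A" and n: "n = pta_encode A"
  shows "ev emptyR [n] = of_bool (\<not> (\<exists>m<2 * n + 3. \<exists>b. fst b \<in> buchi A \<and>
    ((initial A, 0), b) \<in> (edges m n A)\<^sup>* \<and> (b, b) \<in> (edges m n A)\<^sup>+))"
proof -
  let ?B = "size_bound n"
  let ?s = "prod_encode (initial A, 0)"
  define E where "E m = bounded_edges m n" for m
  have E: "ev edgeR [v, u, m, n] \<noteq> 0 \<longleftrightarrow> (u, v) \<in> E m" if "u < ?B" "v < ?B" for u v m
    using that by (simp add: E_def bounded_edges_def)
  have "initial A \<in> states A" using A by (simp add: is_pta_def)
  then have s: "?s < ?B"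
    using pta_encode_bounds(1)[OF A n] by (intro prod_encode_less_size_bound) auto
  have "finite (buchi A)" using A unfolding is_pta_def by (metis finite_subset)
  then have F: "set_decode (tag (arg (arg (arg (arg (arg n)))))) = buchi A"
    by (simp add: pta_encode_components[OF n])
  have init: "triangle (tag (arg (arg (arg (arg n))))) + tag (arg (arg (arg (arg n)))) = ?s"
    by (simp add: pta_encode_components[OF n] prod_encode_def)
  have "ev emptyR [n] = of_bool (\<not> (\<exists>m<2 * n + 3. \<exists>u<?B. \<exists>v<?B. tag u \<in> buchi A \<and>
     ev reachR [u, ?s, m, n] \<noteq> 0 \<and> ev edgeR [v, u, m, n] \<noteq> 0 \<and> ev reachR [u, v, m, n] \<noteq> 0))"
    unfolding F[symmetric] init[symmetric] by (simp add: emptyR_def Let_def del: ev_reachR) blast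
  also have "(\<exists>m<2 * n + 3. \<exists>u<?B. \<exists>v<?B. tag u \<in> buchi A \<and>
     ev reachR [u, ?s, m, n] \<noteq> 0 \<and> ev edgeR [v, u, m, n] \<noteq> 0 \<and> ev reachR [u, v, m, n] \<noteq> 0) \<longleftrightarrow>
     (\<exists>m<2 * n + 3. \<exists>u v. tag u \<in> buchi A \<and> (?s, u) \<in> (E m)\<^sup>* \<and> (u, v) \<in> E m \<and> (v, u) \<in> (E m)\<^sup>*)"
  proof -
    have "(\<exists>u<?B. \<exists>v<?B. tag u \<in> buchi A \<and> ev reachR [u, ?s, m, n] \<noteq> 0 \<and>
        ev edgeR [v, u, m, n] \<noteq> 0 \<and> ev reachR [u, v, m, n] \<noteq> 0) \<longleftrightarrow>
      (\<exists>u v. tag u \<in> buchi A \<and> (?s, u) \<in> (E m)\<^sup>* \<and> (u, v) \<in> E m \<and> (v, u) \<in> (E m)\<^sup>*)"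
      (is "?L \<longleftrightarrow> ?R") for m
    proof
      assume ?L
      then obtain u v where uv: "u < ?B" "v < ?B" and "tag u \<in> buchi A"
        "ev reachR [u, ?s, m, n] \<noteq> 0" "ev edgeR [v, u, m, n] \<noteq> 0" "ev reachR [u, v, m, n] \<noteq> 0"
        by blast
      then have "(?s, u) \<in> (E m)\<^sup>*" "(u, v) \<in> E m" "(v, u) \<in> (E m)\<^sup>*"
        using E[OF uv, of m] s by (simp_all add: E_def)
      with \<open>tag u \<in> buchi A\<close> show ?R by blast
    next
      assume ?R
      then obtain u v where u: "tag u \<in> buchi A" and E': "(?s, u) \<in> (E m)\<^sup>*" "(u, v) \<in> E m"
        "(v, u) \<in> (E m)\<^sup>*"
        by blast
      then have uv: "u < ?B" "v < ?B" by (auto simp: E_def bounded_edges_def)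
      then have "ev reachR [u, ?s, m, n] \<noteq> 0" "ev edgeR [v, u, m, n] \<noteq> 0"
        "ev reachR [u, v, m, n] \<noteq> 0"
        using E[OF uv, of m] s E' by (simp_all add: E_def)
      with u uv show ?L by blast
    qed
    then show ?thesis by (simp only:)
  qed
  also have "\<dots> \<longleftrightarrow> (\<exists>m<2 * n + 3. \<exists>b. fst b \<in> buchi A \<and>
    ((initial A, 0), b) \<in> (edges m n A)\<^sup>* \<and> (b, b) \<in> (edges m n A)\<^sup>+)"
  proof -
    have reach: "(u, v) \<in> (E m)\<^sup>* \<longleftrightarrow> (prod_decode u, prod_decode v) \<in> (edges m n A)\<^sup>*" for u v m
      unfolding E_def bounded_edges_eq[OF A n] by (rule rtrancl_inv_image_bij[OF bij_prod_decode])
    have edge: "(u, v) \<in> E m \<longleftrightarrow> (prod_decode u, prod_decode v) \<in> edges m n A" for u v m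
      unfolding E_def bounded_edges_eq[OF A n] by simp
    have "(\<exists>u v. tag u \<in> buchi A \<and> (?s, u) \<in> (E m)\<^sup>* \<and> (u, v) \<in> E m \<and> (v, u) \<in> (E m)\<^sup>*) \<longleftrightarrow>
      (\<exists>b. fst b \<in> buchi A \<and> ((initial A, 0), b) \<in> (edges m n A)\<^sup>* \<and> (b, b) \<in> (edges m n A)\<^sup>+)"
      (is "?L \<longleftrightarrow> ?R") for m
    proof
      assume ?L
      then obtain u v where "tag u \<in> buchi A" "(?s, u) \<in> (E m)\<^sup>*" "(u, v) \<in> E m" "(v, u) \<in> (E m)\<^sup>*"
        by blast
      then show ?R
        unfolding reach edge
        by (intro exI[of _ "prod_decode u"]) (auto simp: tag_def intro: rtrancl_into_trancl2)
    next
      assume ?R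
      then obtain b c where "fst b \<in> buchi A" "((initial A, 0), b) \<in> (edges m n A)\<^sup>*"
        "(b, c) \<in> edges m n A" "(c, b) \<in> (edges m n A)\<^sup>*"
        by (blast dest: tranclD)
      then show ?L
        unfolding reach edge
        by (intro exI[of _ "prod_encode b"] exI[of _ "prod_encode c"]) (simp add: tag_def)
    qed
    then show ?thesis by (simp only:)
  qed
  finally show ?thesis .
qed

section \<open>Runs and paths of the region graph\<close>

context parameter_positions
begin

lemma edge_of_step:
  assumes A: "is_pta A" "clocks A = {x}" "params A = {p}" and K: "K = pta_encode A"
    and t: "(q, q', \<gamma>, a, S) \<in> transitions A"
    and w: "0 \<le> w" "l \<le> region w" and sat: "sat v I \<gamma>" "v x = w" "I p = \<mu>"
  shows "((q, l), (q', 2 * (region (if x \<in> S then 0 else w) div 2) + 1)) \<in> edges m K A"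
proof -
  have "asat m (region (v x)) \<gamma>"
    using transition_wf(3,4)[OF A(1) t] guard_encode_le[OF A(1) t] A K w sat
    by (subst asat_region[where I = I and p = p]) auto
  then have "asat m (region w) \<gamma>" by (simp add: sat)
  moreover have "region w div 2 < 2 * K + 2" using region_le[OF w(1)] by (simp add: L_eq)
  \<comment> \<open>With one clock, emptiness of \<open>S\<close> tells whether the clock is reset;
    a reset lands in region 0 and yields the bound 1.\<close>
  moreover have "S = {} \<or> S = {x}" using transition_wf(6)[OF A(1) t] A(2) by auto
  then have "2 * (region (if x \<in> S then 0 else w) div 2) + 1 =
      (if S = {} then 2 * (region w div 2) + 1 else 1)"
    by (elim disjE) (simp_all add: region_0)
  ultimately show ?thesis
    unfolding edges_def mem_Collect_eq prod.case
    by (intro exI[of _ \<gamma>] exI[of _ a] exI[of _ S] exI[of _ "region w div 2"]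
        exI[of _ "region w mod 2"]) (simp add: t w(2))
qed

end

lemma timed_language_imp_path:
  assumes A: "is_pta A" "clocks A = {x}" "params A = {p}" and K: "K = pta_encode A"
    and nonempty: "(\<pi>, \<tau>) \<in> timed_language A"
  shows "\<exists>m<2 * K + 3. \<exists>f. recurrent_path (edges m K A) (initial A, 0) fst (buchi A) f"
proof -
  from nonempty obtain I \<rho> where "(\<pi>, \<tau>) \<in> timed_words (alphabet A)" and
    run: "is_run A I (\<pi>, \<tau>) \<rho>" and acc: "accepting A \<rho>"
    unfolding timed_language_def by blast
  then have \<tau>: "\<tau> 0 = 0" "0 \<le> \<tau> 1" "\<And>i. 0 < i \<Longrightarrow> \<tau> i < \<tau> (Suc i)"
    by (auto simp: timed_words_def)
  define v where "v i = snd (\<rho> i) x" for i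
  \<comment> \<open>The clock value before the resets of step \<open>Suc i\<close>, at which its
    guard is tested.\<close>
  define w where "w i = v i + (\<tau> (Suc i) - \<tau> i)" for i
  have conf: "\<rho> i \<in> configs A" for i using run by (simp add: is_run_def)
  have init: "fst (\<rho> 0) = initial A" "v 0 = 0" using run A(2) by (auto simp: is_run_def v_def)
  from run obtain \<gamma> S where "\<forall>i>0. (fst (\<rho> (i - 1)), fst (\<rho> i), \<gamma> i, \<pi> i, S i) \<in> transitions A \<and>
      sat (\<lambda>x. snd (\<rho> (i - 1)) x + (\<tau> i - \<tau> (i - 1))) I (\<gamma> i) \<and>
      (\<forall>x\<in>clocks A. snd (\<rho> i) x =
        (if x \<in> S i then 0 else snd (\<rho> (i - 1)) x + (\<tau> i - \<tau> (i - 1))))"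
    unfolding is_run_def prod.case by blast
  note step_raw = this[rule_format, of "Suc i" for i, simplified]
  have step: "(fst (\<rho> i), fst (\<rho> (Suc i)), \<gamma> (Suc i), \<pi> (Suc i), S (Suc i)) \<in> transitions A"
    "sat (\<lambda>x. snd (\<rho> i) x + (\<tau> (Suc i) - \<tau> i)) I (\<gamma> (Suc i))"
    "v (Suc i) = (if x \<in> S (Suc i) then 0 else w i)" for i
    using step_raw[of i] A(2) by (simp_all add: v_def w_def)
  have v: "0 \<le> v i" for i
    using conf[of i] A(2) by (auto simp: configs_def v_def mem_Times_iff dest: PiE_mem)
  have w: "v i < w i" if "0 < i" for i using \<tau>(3)[OF that] by (simp add: w_def)
  have w_nonneg: "0 \<le> w i" for i
  proof (cases "i = 0")
    case True
    then show ?thesis using \<tau>(1,2) init(2) by (simp add: w_def)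
  next
    case False
    then show ?thesis using w[of i] v[of i] by linarith
  qed
  \<comment> \<open>The positions are adapted to the parameter of this run: its value is one of them
    unless it is negative.\<close>
  obtain P m where m: "m < 2 * K + 3" and "parameter_positions P (2 * K + 1) K (I p) m"
    by (rule parameter_positions_ex)
  moreover define L where "L = 2 * K + 1"
  ultimately interpret parameter_positions P L K "I p" m by simp
  define f where "f i = (fst (\<rho> i), if i = 0 then 0 else 2 * (region (v i) div 2) + 1)" for i
  have "(f i, f (Suc i)) \<in> edges m K A" for i
  proof -
    have "(if i = 0 then 0 else 2 * (region (v i) div 2) + 1) \<le> region (w i)"
      using region_after_delay[OF v w] by simp
    moreover have "snd (\<rho> i) x + (\<tau> (Suc i) - \<tau> i) = w i" by (simp add: w_def v_def)
    ultimately have "((fst (\<rho> i), if i = 0 then 0 else 2 * (region (v i) div 2) + 1),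
        (fst (\<rho> (Suc i)), 2 * (region (v (Suc i)) div 2) + 1)) \<in> edges m K A"
      unfolding step(3) by (rule edge_of_step[OF A K step(1) w_nonneg _ step(2) _ refl])
    then show ?thesis by (simp only: f_def nat.distinct if_False)
  qed
  moreover have "\<exists>q\<in>buchi A. infinite {i. fst (f i) = q}"
    using acc by (simp add: accepting_def f_def)
  ultimately have "recurrent_path (edges m K A) (initial A, 0) fst (buchi A) f"
    using init by (simp add: recurrent_path_def f_def)
  with m show ?thesis by blast
qed

lemma path_imp_timed_language:
  assumes A: "is_pta A" "clocks A = {x}" "params A = {p}" and K: "K = pta_encode A"
    and m: "m < 2 * K + 3" and path: "recurrent_path (edges m K A) (initial A, 0) fst (buchi A) f"
  shows "timed_language A \<noteq> {}"
proof -
  define \<mu> where "\<mu> = (if m = 0 then -1 else real (m - 1) / 2)"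
  define L where "L = 2 * K + 1"
  interpret parameter_positions "\<lambda>j. real j / 2" L K \<mu> m
    unfolding \<mu>_def L_def by (rule half_integer_positions[OF m])
  define I where "I = (\<lambda>y\<in>{p}. \<mu>)"
  have I: "I p = \<mu>" by (simp add: I_def)
  have "\<exists>\<gamma> a S r. (fst (f i), fst (f (Suc i)), \<gamma>, a, S) \<in> transitions A \<and> snd (f i) \<le> r \<and>
      r \<le> 4 * K + 3 \<and> asat m r \<gamma> \<and> snd (f (Suc i)) = (if S = {} then 2 * (r div 2) + 1 else 1)" for i
  proof -
    have "(f i, f (Suc i)) \<in> edges m K A" using path by (simp add: recurrent_path_def)
    then obtain \<gamma> a S h e where t: "(fst (f i), fst (f (Suc i)), \<gamma>, a, S) \<in> transitions A"
      and "h < 2 * K + 2" "e < 2" "snd (f i) \<le> 2 * h + e" "asat m (2 * h + e) \<gamma>"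
      "snd (f (Suc i)) = (if S = {} then 2 * h + 1 else 1)"
      unfolding edges_def by (cases "f i"; cases "f (Suc i)") auto
    then show ?thesis
      by (intro exI[of _ \<gamma>] exI[of _ a] exI[of _ S] exI[of _ "2 * h + e"]) simp
  qed
  then obtain \<gamma> a S r where
    t: "\<And>i. (fst (f i), fst (f (Suc i)), \<gamma> i, a i, S i) \<in> transitions A" and
    r: "\<And>i. snd (f i) \<le> r i" "\<And>i. r i \<le> 4 * K + 3" and
    asat: "\<And>i. asat m (r i) (\<gamma> i)" and
    succ: "\<And>i. snd (f (Suc i)) = (if S i = {} then 2 * (r i div 2) + 1 else 1)"
    by metis
  have S: "S i = {} \<or> S i = {x}" for i using transition_wf(6)[OF A(1) t[of i]] A(2) by auto
  \<comment> \<open>The invariant ties the clock value to the node: positive delays reach exactly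
    the regions from \<open>snd (f i)\<close> on. At \<open>i = 0\<close> the clock is 0 and the
    delay may vanish.\<close>
  define good where "good i v \<longleftrightarrow> 0 \<le> v \<and> (if i = 0 then v = 0
     else snd (f i) = 2 * (region v div 2) + 1)" for i v
  have "\<exists>v. \<forall>i. good i (v i) \<and> (\<exists>w. v i \<le> w \<and> (0 < i \<longrightarrow> v i < w) \<and> region w = r i \<and>
      v (Suc i) = (if x \<in> S i then 0 else w))"
  proof (rule dependent_nat_choice)
    show "\<exists>v. good 0 v" by (simp add: good_def)
  next
    fix v i
    assume v: "good i v"
    have "\<exists>w. v \<le> w \<and> (0 < i \<longrightarrow> v < w) \<and> region w = r i"
    proof (cases "i = 0")
      case True
      obtain w where "0 \<le> w" "region w = r i"
        by (rule region_surj[of "r i"]) (use r(2)[of i] in \<open>simp_all add: L_eq\<close>)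
      then show ?thesis using True v by (auto simp: good_def)
    next
      case False
      then have "0 \<le> v" "2 * (region v div 2) + 1 \<le> r i" using v r(1)[of i] by (auto simp: good_def)
      then obtain w where "v < w" "region w = r i"
        by (rule delay_to_region) (use r(2)[of i] in \<open>simp_all add: L_eq\<close>)
      then show ?thesis by (intro exI[of _ w]) simp
    qed
    then obtain w where w: "v \<le> w" "0 < i \<longrightarrow> v < w" "region w = r i" by blast
    have "good (Suc i) (if x \<in> S i then 0 else w)"
      using S[of i] succ[of i] w v by (auto simp: good_def region_0)
    with w show "\<exists>v'. good (Suc i) v' \<and> (\<exists>w. v \<le> w \<and> (0 < i \<longrightarrow> v < w) \<and> region w = r i \<and>
        v' = (if x \<in> S i then 0 else w))"
      by blast
  qed
  then obtain v where good: "\<And>i. good i (v i)" and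
    "\<forall>i. \<exists>w. v i \<le> w \<and> (0 < i \<longrightarrow> v i < w) \<and> region w = r i \<and>
      v (Suc i) = (if x \<in> S i then 0 else w)" by blast
  then obtain w where w: "\<And>i. v i \<le> w i" "\<And>i. 0 < i \<Longrightarrow> v i < w i" "\<And>i. region (w i) = r i" and
    v_Suc: "\<And>i. v (Suc i) = (if x \<in> S i then 0 else w i)"
    by metis
  have v: "0 \<le> v i" "v 0 = 0" for i using good[of i] good[of 0] by (auto simp: good_def)
  define \<tau> where "\<tau> i = (\<Sum>k<i. w k - v k)" for i
  define \<pi> where "\<pi> = (\<lambda>i\<in>{0<..}. a (i - 1))"
  define \<rho> where "\<rho> i = (fst (f i), \<lambda>y\<in>{x}. v i)" for i
  have "0 \<le> \<tau> i" for i unfolding \<tau>_def using w(1) by (intro sum_nonneg) simp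
  moreover have "\<tau> i < \<tau> (Suc i)" if "0 < i" for i using w(2)[OF that] by (simp add: \<tau>_def)
  moreover have "\<pi> \<in> {0<..} \<rightarrow>\<^sub>E alphabet A"
    using transition_wf(5)[OF A(1) t] by (auto simp: \<pi>_def)
  ultimately have "(\<pi>, \<tau>) \<in> timed_words (alphabet A)" by (simp add: timed_words_def \<tau>_def)
  moreover have "I \<in> params A \<rightarrow>\<^sub>E UNIV" by (simp add: I_def A(3))
  moreover have "accepting A \<rho>"
    using path by (simp add: accepting_def recurrent_path_def \<rho>_def)
  moreover have "is_run A I (\<pi>, \<tau>) \<rho>"
  proof -
    have "\<rho> i \<in> configs A" for i
      using transition_wf(1)[OF A(1) t[of i]] v(1)[of i] A(2) by (simp add: configs_def \<rho>_def)
    moreover have "fst (\<rho> 0) = initial A" using path by (simp add: recurrent_path_def \<rho>_def)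
    moreover have "(fst (\<rho> i), fst (\<rho> (Suc i)), \<gamma> i, \<pi> (Suc i), S i) \<in> transitions A \<and>
        sat (\<lambda>x. snd (\<rho> i) x + (\<tau> (Suc i) - \<tau> i)) I (\<gamma> i) \<and>
        snd (\<rho> (Suc i)) x = (if x \<in> S i then 0 else snd (\<rho> i) x + (\<tau> (Suc i) - \<tau> i))" for i
    proof -
      let ?u = "\<lambda>x. snd (\<rho> i) x + (\<tau> (Suc i) - \<tau> i)"
      have u: "?u x = w i" by (simp add: \<rho>_def \<tau>_def)
      have "asat m (region (?u x)) (\<gamma> i) \<longleftrightarrow> sat ?u I (\<gamma> i)"
      proof (rule asat_region)
        show "0 \<le> ?u x" unfolding u using v(1)[of i] w(1)[of i] by linarith
        show "cc_encode (\<gamma> i) \<le> K" unfolding K by (rule guard_encode_le[OF A(1) t])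
        show "cc_clocks (\<gamma> i) \<subseteq> {x}" "cc_params (\<gamma> i) \<subseteq> {p}"
          using transition_wf(3,4)[OF A(1) t[of i]] A by auto
      qed (rule I)
      then have "sat ?u I (\<gamma> i)" unfolding u w(3) using asat by blast
      moreover have "snd (\<rho> (Suc i)) x = (if x \<in> S i then 0 else ?u x)"
        unfolding u by (simp add: \<rho>_def v_Suc)
      moreover have "(fst (\<rho> i), fst (\<rho> (Suc i)), \<gamma> i, \<pi> (Suc i), S i) \<in> transitions A"
        using t by (simp add: \<rho>_def \<pi>_def)
      ultimately show ?thesis by blast
    qed
    note step = this
    \<comment> \<open>The edges of the path are numbered from 0 but the steps of a run from 1, hence
      the shift of \<open>\<gamma>\<close> and \<open>S\<close>.\<close>
    have "\<forall>i>0. (fst (\<rho> (i - 1)), fst (\<rho> i), \<gamma> (i - 1), \<pi> i, S (i - 1)) \<in> transitions A \<and>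
        sat (\<lambda>x. snd (\<rho> (i - 1)) x + (\<tau> i - \<tau> (i - 1))) I (\<gamma> (i - 1)) \<and>
        (\<forall>y\<in>clocks A. snd (\<rho> i) y =
          (if y \<in> S (i - 1) then 0 else snd (\<rho> (i - 1)) y + (\<tau> i - \<tau> (i - 1))))"
    proof (intro allI impI)
      fix i :: nat
      assume "0 < i"
      then obtain j where "i = Suc j" by (cases i) auto
      with step[of j] A(2) show "(fst (\<rho> (i - 1)), fst (\<rho> i), \<gamma> (i - 1), \<pi> i, S (i - 1)) \<in> transitions A \<and>
        sat (\<lambda>x. snd (\<rho> (i - 1)) x + (\<tau> i - \<tau> (i - 1))) I (\<gamma> (i - 1)) \<and>
        (\<forall>y\<in>clocks A. snd (\<rho> i) y =
          (if y \<in> S (i - 1) then 0 else snd (\<rho> (i - 1)) y + (\<tau> i - \<tau> (i - 1))))"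
        by simp
    qed
    then have "\<exists>\<gamma> S. \<forall>i>0. (fst (\<rho> (i - 1)), fst (\<rho> i), \<gamma> i, \<pi> i, S i) \<in> transitions A \<and>
        sat (\<lambda>x. snd (\<rho> (i - 1)) x + (\<tau> i - \<tau> (i - 1))) I (\<gamma> i) \<and>
        (\<forall>y\<in>clocks A. snd (\<rho> i) y =
          (if y \<in> S i then 0 else snd (\<rho> (i - 1)) y + (\<tau> i - \<tau> (i - 1))))"
      by (intro exI[of _ "\<lambda>i. \<gamma> (i - 1)"] exI[of _ "\<lambda>i. S (i - 1)"])
    moreover have "\<forall>y\<in>clocks A. snd (\<rho> 0) y = 0" by (simp add: A(2) \<rho>_def v(2))
    ultimately show ?thesis unfolding is_run_def by simp
  qed
  ultimately have "(\<pi>, \<tau>) \<in> timed_language A" unfolding timed_language_def by blast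
  then show ?thesis by blast
qed

theorem corollary1:
  "decidable_problem pta_encode
     {A :: (nat, nat, nat, nat) pta. is_pta A \<and> card (clocks A) = 1 \<and> card (params A) = 1}
     (\<lambda>A. timed_language A = {})"
  unfolding decidable_problem_def
proof (intro exI ballI)
  fix A :: "(nat, nat, nat, nat) pta"
  let ?n = "pta_encode A"
  assume "A \<in> {A. is_pta A \<and> card (clocks A) = 1 \<and> card (params A) = 1}"
  then obtain x p where A: "is_pta A" "clocks A = {x}" "params A = {p}"
    by (auto simp: card_1_singleton_iff)
  have "finite ((states A \<times> {..4 * ?n + 3}))" using A(1) by (simp add: is_pta_def)
  note lasso = recurrent_path_iff_lasso[OF edges_subset[OF A(1)] this]
  \<comment> \<open>The code of the automaton doubles as the bound on the constants, so these graphs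
    are the ones that \<open>emptyR\<close> searches.\<close>
  have "timed_language A \<noteq> {} \<longleftrightarrow>
      (\<exists>m<2 * ?n + 3. \<exists>f. recurrent_path (edges m ?n A) (initial A, 0) fst (buchi A) f)"
    using timed_language_imp_path[OF A refl] path_imp_timed_language[OF A refl] by fast
  also have "\<dots> \<longleftrightarrow> (\<exists>m<2 * ?n + 3. \<exists>b. fst b \<in> buchi A \<and>
      ((initial A, 0), b) \<in> (edges m ?n A)\<^sup>* \<and> (b, b) \<in> (edges m ?n A)\<^sup>+)"
    by (simp only: lasso)
  finally have "ev emptyR [?n] = (if timed_language A = {} then 1 else 0)"
    by (simp add: ev_emptyR[OF A(1) refl])
  then show "computes emptyR [?n] (if timed_language A = {} then 1 else 0)"
    using computes_ev[of emptyR "[?n]"] emptyR_arity by simp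
qed

end
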